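(* Let $q\ge1$, $p<p_c(q)=\frac{\sqrt q}{\sqrt q+1}$, and let $\eta$ be a side-homogeneous boundary condition on $\Lambda_n$. Then the mixing time of the discrete-time Glauber dynamics on $\Lambda_n$ with boundary condition $\eta$ is $\Omega(n^2\log n)$, i.e., at least $c\,n^2\log n$ for a constant $c>0$ depending only on $p,q$ and all sufficiently large $n$.
   Context: $\Lambda_n=(\Lambda_n,E_n)$ is the $n\times n$ box of $\mathbb Z^2$ with nearest-neighbor edges; $\partial\Lambda_n$ its set of vertices with a $\mathbb Z^2$-neighbor outside. A boundary condition $\eta$ is a partition of $\partial\Lambda_n$; $\mu^\eta_{\Lambda_n,p,q}(A)\propto p^{|A|}(1-p)^{|E_n\setminus A|}q^{c(A,\eta)}$, where $c(A,\eta)$ counts components of $(\Lambda_n,A)$ with components containing vertices of a common block of $\eta$ identified. With $L_1,\dots,L_4$ the vertex sets of the four sides, $\eta$ is side-homogeneous if (P1) at most one block has more than one element and (P2) such a block is a union of some of the $L_j$. The Glauber dynamics picks $e\in E_n$ uniformly at random and sets $e$ open with probability $\frac{\mu^\eta(A\cup\{e\})}{\mu^\eta(A\cup\{e\})+\mu^\eta(A\setminus\{e\})}$, closed otherwise. Mixing time: $\tau_{\rm mix}=\max_{X_0}\min\{t:\|\mathcal M^t(X_0,\cdot)-\mu^\eta\|_{TV}\le1/4\}$. *)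

theory Defs
  imports Complex_Main "HOL-Library.Disjoint_Sets"
begin

type_synonym vtx = "int \<times> int"

definition box :: "nat \<Rightarrow> vtx set" where
  "box n = {0..<int n} \<times> {0..<int n}"

definition adj :: "vtx \<Rightarrow> vtx \<Rightarrow> bool" where
  "adj u v \<longleftrightarrow> \<bar>fst u - fst v\<bar> + \<bar>snd u - snd v\<bar> = 1"

definition box_edges :: "nat \<Rightarrow> vtx set set" where
  "box_edges n = {{u, v} | u v. u \<in> box n \<and> v \<in> box n \<and> adj u v}"

definition boundary :: "nat \<Rightarrow> vtx set" where
  "boundary n = {v \<in> box n. \<exists>w. adj v w \<and> w \<notin> box n}"

definition sides :: "nat \<Rightarrow> vtx set set" where
  "sides n = {{0} \<times> {0..<int n}, {int n - 1} \<times> {0..<int n},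
              {0..<int n} \<times> {0}, {0..<int n} \<times> {int n - 1}}"

definition side_homogeneous :: "nat \<Rightarrow> vtx set set \<Rightarrow> bool" where
  "side_homogeneous n \<eta> \<longleftrightarrow>
     (\<forall>B\<in>\<eta>. \<forall>B'\<in>\<eta>. card B > 1 \<and> card B' > 1 \<longrightarrow> B = B') \<and>
     (\<forall>B\<in>\<eta>. card B > 1 \<longrightarrow> (\<exists>S \<subseteq> sides n. B = \<Union>S))"

definition conn :: "vtx set set \<Rightarrow> vtx set set \<Rightarrow> (vtx \<times> vtx) set" where
  "conn A \<eta> = ({(u, v). {u, v} \<in> A} \<union> {(u, v). \<exists>B\<in>\<eta>. u \<in> B \<and> v \<in> B})\<^sup>*"

definition ncomp :: "nat \<Rightarrow> vtx set set \<Rightarrow> vtx set set \<Rightarrow> nat" where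
  "ncomp n A \<eta> = card (box n // conn A \<eta>)"

definition rc_weight :: "nat \<Rightarrow> real \<Rightarrow> real \<Rightarrow> vtx set set \<Rightarrow> vtx set set \<Rightarrow> real" where
  "rc_weight n p q \<eta> A =
     p ^ card A * (1 - p) ^ card (box_edges n - A) * q ^ ncomp n A \<eta>"

definition rc_measure :: "nat \<Rightarrow> real \<Rightarrow> real \<Rightarrow> vtx set set \<Rightarrow> vtx set set \<Rightarrow> real" where
  "rc_measure n p q \<eta> A =
     rc_weight n p q \<eta> A / (\<Sum>B\<in>Pow (box_edges n). rc_weight n p q \<eta> B)"

definition glauber :: "nat \<Rightarrow> real \<Rightarrow> real \<Rightarrow> vtx set set \<Rightarrow> vtx set set \<Rightarrow> vtx set set \<Rightarrow> real" where
  "glauber n p q \<eta> A B =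
     (\<Sum>e\<in>box_edges n.
        (let a = rc_measure n p q \<eta> (A \<union> {e}); b = rc_measure n p q \<eta> (A - {e}) in
          (if B = A \<union> {e} then a / (a + b) else 0) + (if B = A - {e} then b / (a + b) else 0)))
     / real (card (box_edges n))"

definition dist_step :: "nat \<Rightarrow> real \<Rightarrow> real \<Rightarrow> vtx set set \<Rightarrow> (vtx set set \<Rightarrow> real) \<Rightarrow> vtx set set \<Rightarrow> real" where
  "dist_step n p q \<eta> d B = (\<Sum>A\<in>Pow (box_edges n). d A * glauber n p q \<eta> A B)"

definition dist_at :: "nat \<Rightarrow> real \<Rightarrow> real \<Rightarrow> vtx set set \<Rightarrow> vtx set set \<Rightarrow> nat \<Rightarrow> vtx set set \<Rightarrow> real" where
  "dist_at n p q \<eta> X0 t = (dist_step n p q \<eta> ^^ t) (\<lambda>B. if B = X0 then 1 else 0)"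

definition tv_dist :: "nat \<Rightarrow> (vtx set set \<Rightarrow> real) \<Rightarrow> (vtx set set \<Rightarrow> real) \<Rightarrow> real" where
  "tv_dist n d1 d2 = (\<Sum>B\<in>Pow (box_edges n). \<bar>d1 B - d2 B\<bar>) / 2"

definition mixing_time :: "nat \<Rightarrow> real \<Rightarrow> real \<Rightarrow> vtx set set \<Rightarrow> nat" where
  "mixing_time n p q \<eta> =
     Max ((\<lambda>X0. LEAST t. tv_dist n (dist_at n p q \<eta> X0 t) (rc_measure n p q \<eta>) \<le> 1 / 4)
          ` Pow (box_edges n))"

end

theory Submission
  imports Defs "HOL-Analysis.Convex" "HOL-Real_Asymp.Real_Asymp"
begin

text \<open>
  Let \<open>F\<close> be the number of open edges and \<open>m\<close> the number of edges, and suppose that the chain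
  is mixed at a time \<open>T\<close> of order at most \<open>n\<^sup>2 log n\<close>. Two observations contradict each other;
  neither involves decay of correlations.

  First, \<open>F\<close> is concentrated: it changes by at most one per step, so its Dirichlet form is
  bounded, and the spectral gap of a reversible chain that is mixed at time \<open>T\<close> is of order
  at least \<open>1 / T\<close>; hence the stationary variance of \<open>F\<close> is \<open>O(T)\<close>.

  Second, couple the chain \<open>X\<close> from the empty configuration monotonically below a
  stationary chain \<open>Y\<close>. An edge that has not been updated by time \<open>T\<close> is closed in \<open>X\<close> and has
  its initial state in \<open>Y\<close>, and the set of such edges is independent of the initial state. So
  \<open>F Y - F X\<close> is, up to small fluctuations, at least \<open>(1 - 1 / m) ^ T\<close> times the mean of \<open>F\<close>. For
  \<open>T \<le> n\<^sup>2 log n / 8\<close> this is at least of order \<open>n\<^bsup>3/2\<^esup>\<close>, far above the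
  standard deviation of \<open>F\<close>.
\<close>

section \<open>Markov operators\<close>

text \<open>A Markov kernel is encoded by its action on observables: \<open>P f x\<close> is the
  mean of \<open>f\<close> after one step from \<open>x\<close>. Requiring monotonicity only on
  \<open>S\<close> makes \<open>S\<close> an invariant set.\<close>

locale markov_operator =
  fixes S :: "'s set" and P :: "('s \<Rightarrow> real) \<Rightarrow> 's \<Rightarrow> real"
  assumes linear: "P (\<lambda>x. a * f x + b * g x) = (\<lambda>x. a * P f x + b * P g x)"
    and mono: "\<lbrakk>\<And>y. y \<in> S \<Longrightarrow> f y \<le> g y; x \<in> S\<rbrakk> \<Longrightarrow> P f x \<le> P g x"
    and const: "x \<in> S \<Longrightarrow> P (\<lambda>_. c) x = c"
begin

lemma cong_on: "\<lbrakk>\<And>y. y \<in> S \<Longrightarrow> f y = g y; x \<in> S\<rbrakk> \<Longrightarrow> P f x = P g x"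
  by (intro antisym mono) auto

lemma scale: "P (\<lambda>x. a * f x) x = a * P f x"
  using fun_cong[OF linear[of a f 0 f], of x] by simp

lemma add: "P (\<lambda>x. f x + g x) x = P f x + P g x"
  using fun_cong[OF linear[of 1 f 1 g], of x] by simp

lemma affine: "x \<in> S \<Longrightarrow> P (\<lambda>y. a * f y + c) x = a * P f x + c"
  by (simp add: add scale const)

lemma abs_le: "\<lbrakk>\<And>y. y \<in> S \<Longrightarrow> \<bar>f y\<bar> \<le> M; x \<in> S\<rbrakk> \<Longrightarrow> \<bar>P f x\<bar> \<le> M"
  using mono[of f "\<lambda>_. M" x] mono[of "\<lambda>_. - M" f x] const[of x]
  by (fastforce simp: abs_le_iff minus_le_iff)

lemma nonneg: "\<lbrakk>\<And>y. y \<in> S \<Longrightarrow> 0 \<le> f y; x \<in> S\<rbrakk> \<Longrightarrow> 0 \<le> P f x"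
  using mono[of "\<lambda>_. 0" f x] const[of x 0] by simp

lemma markov_operator_funpow: "markov_operator S (P ^^ t)"
proof (induction t)
  case 0
  show ?case by unfold_locales auto
next
  case (Suc t)
  interpret Pt: markov_operator S "P ^^ t" by fact
  show ?case
  proof
    fix x c assume "x \<in> S"
    then show "(P ^^ Suc t) (\<lambda>_. c) x = c"
      by (simp add: cong_on[of "(P ^^ t) (\<lambda>_. c)" "\<lambda>_. c"] Pt.const const)
  qed (auto simp: linear Pt.linear intro!: mono Pt.mono)
qed

lemma eigenfunction_funpow:
  assumes "\<And>y. y \<in> S \<Longrightarrow> P h y = c * h y" and "x \<in> S"
  shows "(P ^^ t) h x = c ^ t * h x"
  using assms(2)
proof (induction t arbitrary: x)
  case (Suc t)
  have "(P ^^ Suc t) h x = P (\<lambda>y. c ^ t * h y) x"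
    using Suc cong_on[of "(P ^^ t) h" "\<lambda>y. c ^ t * h y" x] by simp
  also have "\<dots> = c ^ Suc t * h x"
    by (simp add: scale assms(1) Suc.prems)
  finally show ?case .
qed simp

text \<open>All starting points send mass at least \<delta> to the same \<open>z\<close>. This
  common mass shifts the centre \<open>a\<close> towards \<open>g z\<close>, and only the remaining
  mass \<open>1 - \<delta>\<close> spreads the values.\<close>

lemma Doeblin_contraction:
  assumes z: "z \<in> S" and \<delta>: "\<And>x. x \<in> S \<Longrightarrow> \<delta> \<le> P (\<lambda>y. if y = z then 1 else 0) x"
    and g: "\<And>y. y \<in> S \<Longrightarrow> \<bar>g y - a\<bar> \<le> M" and x: "x \<in> S"
  shows "\<bar>P g x - (a + \<delta> * (g z - a))\<bar> \<le> (1 - \<delta>) * M"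
proof -
  let ?i = "\<lambda>y. if y = z then 1 else (0::real)"
  have gz: "\<bar>g z - a\<bar> \<le> M" using g z by blast
  \<comment> \<open>The majorant is \<open>g z\<close> at \<open>z\<close> and \<open>a + M\<close>
    elsewhere. Its slope in the indicator is nonpositive, so the lower bound \<delta> yields an
    upper bound.\<close>
  have "P g x \<le> P (\<lambda>y. (g z - a - M) * ?i y + (a + M)) x"
    by (rule mono[OF _ x]) (use g in \<open>force simp: abs_le_iff\<close>)
  also have "\<dots> = (g z - a - M) * P ?i x + (a + M)"
    by (rule affine[OF x])
  also have "\<dots> \<le> (g z - a - M) * \<delta> + (a + M)"
    using gz \<delta>[OF x] by (simp add: mult_left_mono_neg)
  finally have 1: "P g x \<le> (g z - a - M) * \<delta> + (a + M)" .
  have "(g z - a + M) * \<delta> + (a - M) \<le> (g z - a + M) * P ?i x + (a - M)"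
    using gz \<delta>[OF x] by (simp add: mult_left_mono)
  also have "\<dots> = P (\<lambda>y. (g z - a + M) * ?i y + (a - M)) x"
    by (rule affine[OF x, symmetric])
  also have "\<dots> \<le> P g x"
    by (rule mono[OF _ x]) (use g in \<open>force simp: abs_le_iff\<close>)
  finally show ?thesis
    using 1 by (simp add: abs_le_iff algebra_simps)
qed

end

text \<open>One-step intertwining iterates: this is what makes each marginal of a coupling a copy of
  the original chain at all times.\<close>

lemma funpow_projection:
  assumes "markov_operator S Q" "markov_operator S' P"
    and "\<And>g s. s \<in> S \<Longrightarrow> Q (\<lambda>s. g (\<pi> s)) s = P g (\<pi> s)" and "s \<in> S"
  shows "(Q ^^ t) (\<lambda>s. g (\<pi> s)) s = (P ^^ t) g (\<pi> s)"
  using assms(4)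
proof (induction t arbitrary: s g)
  case (Suc t)
  interpret Qt: markov_operator S "Q ^^ t"
    by (rule markov_operator.markov_operator_funpow) fact
  have "(Q ^^ Suc t) (\<lambda>s. g (\<pi> s)) s = (Q ^^ t) (Q (\<lambda>s. g (\<pi> s))) s"
    by (simp add: funpow_swap1)
  also have "\<dots> = (Q ^^ t) (\<lambda>s. P g (\<pi> s)) s"
    by (rule Qt.cong_on) (use assms(3) Suc.prems in auto)
  also have "\<dots> = (P ^^ Suc t) g (\<pi> s)"
    by (simp add: Suc.IH Suc.prems funpow_swap1)
  finally show ?case .
qed simp

text \<open>Reversibility is put as self-adjointness for the weighted inner product. Testing it
  against the constant 1 gives stationarity.\<close>

locale reversible_operator = markov_operator +
  fixes \<pi> :: "'a \<Rightarrow> real"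
  assumes finite_states: "finite S"
    and \<pi>_nonneg: "x \<in> S \<Longrightarrow> 0 \<le> \<pi> x"
    and \<pi>_sum: "sum \<pi> S = 1"
    and selfadjoint: "(\<Sum>x\<in>S. \<pi> x * (P f x * g x)) = (\<Sum>x\<in>S. \<pi> x * (f x * P g x))"
begin

definition mean :: "('a \<Rightarrow> real) \<Rightarrow> real" where
  "mean f = (\<Sum>x\<in>S. \<pi> x * f x)"

lemma mean_mono: "(\<And>x. x \<in> S \<Longrightarrow> f x \<le> g x) \<Longrightarrow> mean f \<le> mean g"
  unfolding mean_def by (intro sum_mono mult_left_mono \<pi>_nonneg)

lemma mean_cong: "(\<And>x. x \<in> S \<Longrightarrow> f x = g x) \<Longrightarrow> mean f = mean g"
  unfolding mean_def by simp

lemma mean_const: "mean (\<lambda>_. c) = c"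
  using \<pi>_sum by (simp add: mean_def flip: sum_distrib_right)

lemma mean_scale: "mean (\<lambda>x. a * f x) = a * mean f"
  unfolding mean_def by (simp add: sum_distrib_left mult_ac)

lemma mean_add: "mean (\<lambda>x. f x + g x) = mean f + mean g"
  unfolding mean_def by (simp add: sum.distrib distrib_left)

lemma mean_diff: "mean (\<lambda>x. f x - g x) = mean f - mean g"
  unfolding mean_def by (simp add: sum_subtractf right_diff_distrib)

lemma mean_abs_le: "(\<And>x. x \<in> S \<Longrightarrow> \<bar>f x\<bar> \<le> M) \<Longrightarrow> \<bar>mean f\<bar> \<le> M"
  using mean_mono[of f "\<lambda>_. M"] mean_mono[of "\<lambda>_. - M" f]
  by (fastforce simp: mean_const abs_le_iff minus_le_iff)

lemma mean_stationary: "mean (P f) = mean f"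
  using selfadjoint[of f "\<lambda>_. 1"] by (simp add: mean_def const)

lemma mean_stationary_funpow: "mean ((P ^^ t) f) = mean f"
  by (induction t) (auto simp: mean_stationary)

lemma mean_Cauchy_Schwarz:
  "(mean (\<lambda>x. f x * g x))\<^sup>2 \<le> mean (\<lambda>x. (f x)\<^sup>2) * mean (\<lambda>x. (g x)\<^sup>2)"
proof -
  have sq: "mean (\<lambda>x. (h x)\<^sup>2) = (\<Sum>x\<in>S. (sqrt (\<pi> x) * h x)\<^sup>2)" for h
    unfolding mean_def by (rule sum.cong) (auto simp: power_mult_distrib \<pi>_nonneg)
  have "mean (\<lambda>x. f x * g x) = (\<Sum>x\<in>S. (sqrt (\<pi> x) * f x) * (sqrt (\<pi> x) * g x))"
    unfolding mean_def
  proof (rule sum.cong)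
    fix x assume "x \<in> S"
    then have "sqrt (\<pi> x) * sqrt (\<pi> x) = \<pi> x"
      by (simp add: \<pi>_nonneg)
    then show "\<pi> x * (f x * g x) = sqrt (\<pi> x) * f x * (sqrt (\<pi> x) * g x)"
      by (metis mult.assoc mult.left_commute)
  qed simp
  then show ?thesis
    unfolding sq using Cauchy_Schwarz_ineq_sum by metis
qed

text \<open>The dual form of total variation: the supremum over test functions bounded by 1 is twice
  the distance, so \<open>1 / 2\<close> stands for distance \<open>1 / 4\<close>.\<close>

definition mixed :: "nat \<Rightarrow> 'a \<Rightarrow> bool" where
  "mixed t x \<longleftrightarrow> (\<forall>g. (\<forall>y\<in>S. \<bar>g y\<bar> \<le> 1) \<longrightarrow> \<bar>(P ^^ t) g x - mean g\<bar> \<le> 1 / 2)"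

text \<open>\<open>P\<close> contracts the sup norm and preserves the mean, so \<open>P g\<close> is
  again an admissible test function.\<close>

lemma mixed_mono:
  assumes "mixed t x" "t \<le> t'"
  shows "mixed t' x"
  using assms(2,1)
proof (induction rule: dec_induct)
  case (step n)
  show ?case
    unfolding mixed_def
  proof (intro allI impI)
    fix g :: "'a \<Rightarrow> real" assume "\<forall>y\<in>S. \<bar>g y\<bar> \<le> 1"
    then have "\<forall>y\<in>S. \<bar>P g y\<bar> \<le> 1"
      by (auto intro: abs_le)
    with step have "\<bar>(P ^^ n) (P g) x - mean (P g)\<bar> \<le> 1 / 2"
      unfolding mixed_def by blast
    then show "\<bar>(P ^^ Suc n) g x - mean g\<bar> \<le> 1 / 2"
      by (simp add: funpow_swap1 mean_stationary)
  qed
qed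

lemma mixed_bound:
  assumes "mixed t x" and M: "\<And>y. y \<in> S \<Longrightarrow> \<bar>g y\<bar> \<le> M" and x: "x \<in> S"
  shows "\<bar>(P ^^ t) g x - mean g\<bar> \<le> M / 2"
proof (cases "M > 0")
  case True
  interpret Pt: markov_operator S "P ^^ t" by (rule markov_operator_funpow)
  have "\<forall>y\<in>S. \<bar>(1 / M) * g y\<bar> \<le> 1"
    using M True by (simp add: abs_mult)
  with assms(1) have "\<bar>(P ^^ t) (\<lambda>y. (1 / M) * g y) x - mean (\<lambda>y. (1 / M) * g y)\<bar> \<le> 1 / 2"
    unfolding mixed_def by (elim allE[of _ "\<lambda>y. (1 / M) * g y"] impE)
  also have "(P ^^ t) (\<lambda>y. (1 / M) * g y) x - mean (\<lambda>y. (1 / M) * g y)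
      = ((P ^^ t) g x - mean g) / M"
    by (simp only: Pt.scale mean_scale) (simp add: diff_divide_distrib)
  finally show ?thesis
    using True by (simp add: abs_divide divide_le_eq)
next
  case False
  interpret Pt: markov_operator S "P ^^ t" by (rule markov_operator_funpow)
  have g0: "g y = 0" if "y \<in> S" for y
    using M[OF that] False by linarith
  have "M = 0" using M[OF x] False by linarith
  moreover have "(P ^^ t) g x = 0"
    using Pt.cong_on[of g "\<lambda>_. 0" x] g0 x by (simp add: Pt.const)
  moreover have "mean g = 0"
    using mean_cong[of g "\<lambda>_. 0"] g0 by (simp add: mean_const)
  ultimately show ?thesis by simp
qed

text \<open>Finiteness gives one \<delta> for all starting points, and the Doeblin contraction is
  iterated in blocks of \<open>m\<close> steps.\<close>

lemma eventually_mixed: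
  assumes z: "z \<in> S" and pos: "\<And>x. x \<in> S \<Longrightarrow> 0 < (P ^^ m) (\<lambda>y. if y = z then 1 else 0) x"
  shows "\<exists>t. \<forall>x\<in>S. mixed t x"
proof -
  let ?h = "(P ^^ m) (\<lambda>y. if y = z then 1 else 0)"
  interpret Pm: markov_operator S "P ^^ m" by (rule markov_operator_funpow)
  define \<delta> where "\<delta> = Min (?h ` S)"
  have \<delta>: "\<delta> \<le> ?h x" if "x \<in> S" for x
    unfolding \<delta>_def using finite_states that by simp
  have "\<delta> > 0"
    unfolding \<delta>_def using finite_states z pos by (subst Min_gr_iff) auto
  have "?h z \<le> 1"
    using Pm.mono[of "\<lambda>y. if y = z then 1 else 0" "\<lambda>_. 1" z] z by (simp add: Pm.const)
  then have "\<delta> \<le> 1" using \<delta>[OF z] by linarith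
  have contract: "\<exists>a. \<forall>x\<in>S. \<bar>(P ^^ (j * m)) g x - a\<bar> \<le> (1 - \<delta>) ^ j"
    if "\<forall>y\<in>S. \<bar>g y\<bar> \<le> 1" for j g
  proof (induction j)
    case 0
    show ?case using that by (auto intro!: exI[of _ 0])
  next
    case (Suc j)
    then obtain a where "\<forall>x\<in>S. \<bar>(P ^^ (j * m)) g x - a\<bar> \<le> (1 - \<delta>) ^ j" by blast
    then have "\<forall>x\<in>S. \<bar>(P ^^ m) ((P ^^ (j * m)) g) x - (a + \<delta> * ((P ^^ (j * m)) g z - a))\<bar>
        \<le> (1 - \<delta>) * (1 - \<delta>) ^ j"
      using Pm.Doeblin_contraction[OF z \<delta>] by blast
    then show ?case
      by (auto simp: funpow_add)
  qed
  have "1 - \<delta> < 1" "0 \<le> 1 - \<delta>" using \<open>\<delta> > 0\<close> \<open>\<delta> \<le> 1\<close> by auto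
  \<comment> \<open>Both the value at time \<open>j * m\<close> and the mean lie this close to a
    common \<open>a\<close>; two such errors add up to at most \<open>1 / 2\<close>.\<close>
  then obtain j where j: "(1 - \<delta>) ^ j < 1 / 4"
    using real_arch_pow_inv[of "1 / 4" "1 - \<delta>"] by auto
  have "mixed (j * m) x" if x: "x \<in> S" for x
    unfolding mixed_def
  proof (intro allI impI)
    fix g :: "'a \<Rightarrow> real" assume "\<forall>y\<in>S. \<bar>g y\<bar> \<le> 1"
    then obtain a where a: "\<And>x. x \<in> S \<Longrightarrow> \<bar>(P ^^ (j * m)) g x - a\<bar> \<le> (1 - \<delta>) ^ j"
      using contract by blast
    have "\<bar>mean (\<lambda>x. (P ^^ (j * m)) g x - a)\<bar> \<le> (1 - \<delta>) ^ j"
      by (rule mean_abs_le) (rule a)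
    then have "\<bar>mean g - a\<bar> \<le> (1 - \<delta>) ^ j"
      by (simp only: mean_diff mean_stationary_funpow mean_const)
    then show "\<bar>(P ^^ (j * m)) g x - mean g\<bar> \<le> 1 / 2"
      using a[OF x] j by linarith
  qed
  then show ?thesis by blast
qed

text \<open>The stationary mean square increment is twice
  \<open>mean (f * f) - mean (f * P f)\<close>. Nonnegativity of the mean square of
  \<open>f - P f\<close> then replaces the cross term.\<close>

lemma mean_energy:
  assumes "\<And>x. x \<in> S \<Longrightarrow> P (\<lambda>y. (f y - f x)\<^sup>2) x \<le> 1"
  shows "mean (\<lambda>x. (f x)\<^sup>2) - mean (\<lambda>x. (P f x)\<^sup>2) \<le> 1"
proof -
  have "P (\<lambda>y. (f y - f x)\<^sup>2) x = P (\<lambda>y. (f y)\<^sup>2) x - 2 * (f x * P f x) + (f x)\<^sup>2"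
    if "x \<in> S" for x
  proof -
    have "P (\<lambda>y. (f y - f x)\<^sup>2) x = P (\<lambda>y. (f y)\<^sup>2 + ((- 2 * f x) * f y + (f x)\<^sup>2)) x"
      by (rule arg_cong[where f = "\<lambda>h. P h x"]) (auto simp: power2_eq_square algebra_simps)
    also have "\<dots> = P (\<lambda>y. (f y)\<^sup>2) x + ((- 2 * f x) * P f x + (f x)\<^sup>2)"
      by (simp only: add scale const[OF that])
    finally show ?thesis by (simp add: mult.assoc)
  qed
  then have "mean (\<lambda>x. P (\<lambda>y. (f y)\<^sup>2) x - 2 * (f x * P f x) + (f x)\<^sup>2) \<le> mean (\<lambda>_. 1)"
    using assms by (intro mean_mono) auto
  then have "2 * mean (\<lambda>x. (f x)\<^sup>2) - 2 * mean (\<lambda>x. f x * P f x) \<le> 1"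
    by (simp only: mean_add mean_diff mean_scale mean_stationary mean_const)
  moreover have "mean (\<lambda>_. 0) \<le> mean (\<lambda>x. (f x)\<^sup>2 - 2 * (f x * P f x) + (P f x)\<^sup>2)"
    using zero_le_power2[of "f x - P f x" for x]
    by (intro mean_mono) (simp add: power2_diff mult.assoc algebra_simps)
  then have "0 \<le> mean (\<lambda>x. (f x)\<^sup>2) - 2 * mean (\<lambda>x. f x * P f x) + mean (\<lambda>x. (P f x)\<^sup>2)"
    by (simp only: mean_add mean_diff mean_scale mean_const)
  ultimately show ?thesis by linarith
qed

text \<open>Self-adjointness moves one factor \<open>P\<close> across the inner product;
  Cauchy-Schwarz does the rest.\<close>

lemma mean_log_convex:
  "(mean (\<lambda>x. ((P ^^ Suc k) f x)\<^sup>2))\<^sup>2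
     \<le> mean (\<lambda>x. ((P ^^ k) f x)\<^sup>2) * mean (\<lambda>x. ((P ^^ Suc (Suc k)) f x)\<^sup>2)"
proof -
  have "mean (\<lambda>x. ((P ^^ Suc k) f x)\<^sup>2) = mean (\<lambda>x. (P ^^ k) f x * (P ^^ Suc (Suc k)) f x)"
    using selfadjoint[of "(P ^^ k) f" "(P ^^ Suc k) f"] by (simp add: mean_def power2_eq_square)
  then show ?thesis using mean_Cauchy_Schwarz by metis
qed

end

text \<open>A substitute for the spectral gap. Log-convexity makes the ratios of successive terms
  nondecreasing, so \<open>a k\<close> is at least \<open>a 0 * r ^ k\<close> with the first ratio
  \<open>r\<close>. The decay forces \<open>4 * r ^ T \<le> 1\<close>, and Bernoulli's inequality
  turns this into a bound on \<open>1 - r\<close>.\<close>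

lemma log_convex_decay:
  fixes a :: "nat \<Rightarrow> real"
  assumes nonneg: "\<And>k. 0 \<le> a k" and convex: "\<And>k. (a (Suc k))\<^sup>2 \<le> a k * a (Suc (Suc k))"
    and decay: "\<And>j. a (j * T) \<le> C / 4 ^ j"
  shows "3 / 4 * a 0 \<le> real T * (a 0 - a 1)"
proof (cases "a 0 > 0")
  case True
  define r where "r = a 1 / a 0"
  have "r \<ge> 0" unfolding r_def using nonneg by simp
  have geometric: "a 0 * r ^ k \<le> a k" for k
  proof (cases "r = 0")
    case True
    then show ?thesis using nonneg by (cases k) auto
  next
    case False
    with \<open>r \<ge> 0\<close> have "r > 0" by simp
    have "a k > 0 \<and> r * a k \<le> a (Suc k)" for k
    proof (induction k)
      case 0
      then show ?case using \<open>a 0 > 0\<close> by (simp add: r_def)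
    next
      case (Suc k)
      then have pos: "a (Suc k) > 0"
        using \<open>r > 0\<close> by (smt (verit) mult_pos_pos)
      have "r * a (Suc k) * a k \<le> a (Suc k) * a (Suc k)"
        using Suc pos by (simp add: mult.commute mult.left_commute)
      also have "\<dots> \<le> a (Suc (Suc k)) * a k"
        using convex[of k] by (simp add: power2_eq_square mult.commute)
      finally show ?case using pos Suc by simp
    qed
    then have step: "r * a k \<le> a (Suc k)" for k by blast
    show ?thesis
    proof (induction k)
      case (Suc k)
      have "a 0 * r ^ Suc k = r * (a 0 * r ^ k)" by simp
      also have "\<dots> \<le> r * a k" using Suc \<open>r > 0\<close> by simp
      also have "\<dots> \<le> a (Suc k)" by (rule step)
      finally show ?case .
    qed simp
  qed
  have "4 * r ^ T \<le> 1"
  proof (rule ccontr)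
    assume "\<not> ?thesis"
    \<comment> \<open>A base above 1 has unbounded powers, whereas all of them are at most
      \<open>C / a 0\<close>.\<close>
    then obtain j where "C / a 0 < (4 * r ^ T) ^ j"
      using real_arch_pow[of "4 * r ^ T" "C / a 0"] by auto
    moreover have "a 0 * (4 * r ^ T) ^ j \<le> C"
      using order_trans[OF geometric[of "j * T"] decay[of j]]
      by (simp add: power_mult_distrib field_simps flip: power_mult)
    ultimately show False using True by (simp add: field_simps)
  qed
  moreover have "1 + real T * (r - 1) \<le> r ^ T"
    using Bernoulli_inequality[of "r - 1" T] \<open>r \<ge> 0\<close> by simp
  ultimately have "3 / 4 \<le> real T * (1 - r)" by (simp add: algebra_simps)
  then have "3 / 4 * a 0 \<le> real T * (1 - r) * a 0"
    using True by (intro mult_right_mono) auto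
  also have "\<dots> = real T * ((1 - r) * a 0)" by (rule mult.assoc)
  also have "(1 - r) * a 0 = a 0 - a 1"
    using True by (simp add: r_def field_simps)
  finally show ?thesis .
next
  case False
  then have "a 0 = 0" using nonneg[of 0] by linarith
  moreover from this have "a 1 = 0" using convex[of 0] by simp
  ultimately show ?thesis by simp
qed

section \<open>Variance of a Lipschitz observable of a mixed chain\<close>

context reversible_operator
begin

text \<open>Every \<open>T\<close> steps halve the sup norm of the centred observable, hence quarter
  the bound on its second moment, while a single step lowers the second moment by at most 1.\<close>

lemma variance_le_mixing_time:
  assumes mixed: "\<And>x. x \<in> S \<Longrightarrow> mixed T x"
    and lip: "\<And>x. x \<in> S \<Longrightarrow> P (\<lambda>y. (F y - F x)\<^sup>2) x \<le> 1"
  shows "mean (\<lambda>x. (F x - mean F)\<^sup>2) \<le> 4 / 3 * real T"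
proof -
  define f where "f = (\<lambda>x. F x - mean F)"
  define M where "M = (\<Sum>x\<in>S. \<bar>f x\<bar>)"
  define a where "a k = mean (\<lambda>x. ((P ^^ k) f x)\<^sup>2)" for k
  have mean_f: "mean ((P ^^ k) f) = 0" for k
    by (simp add: mean_stationary_funpow f_def mean_diff mean_const)
  have sup: "\<bar>(P ^^ (j * T)) f x\<bar> \<le> M / 2 ^ j" if "x \<in> S" for x j
    using that
  proof (induction j arbitrary: x)
    case 0
    then show ?case unfolding M_def using finite_states
      by (auto intro!: member_le_sum[of x S "\<lambda>x. \<bar>f x\<bar>"])
  next
    case (Suc j)
    have "\<bar>(P ^^ T) ((P ^^ (j * T)) f) x - mean ((P ^^ (j * T)) f)\<bar> \<le> (M / 2 ^ j) / 2"
      by (rule mixed_bound) (use mixed Suc in auto)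
    then show ?case
      by (simp add: mean_f funpow_add mult.commute)
  qed
  have decay: "a (j * T) \<le> M\<^sup>2 / 4 ^ j" for j
  proof -
    have "a (j * T) \<le> mean (\<lambda>_. (M / 2 ^ j)\<^sup>2)"
      unfolding a_def using sup by (intro mean_mono) (meson abs_le_square_iff abs_ge_self order_trans)
    also have "\<dots> = M\<^sup>2 / (2\<^sup>2) ^ j"
      by (simp only: mean_const power_divide) (simp only: mult.commute flip: power_mult)
    finally show ?thesis by simp
  qed
  have "3 / 4 * a 0 \<le> real T * (a 0 - a 1)"
  proof (rule log_convex_decay)
    show "0 \<le> a k" for k
      unfolding a_def using mean_mono[of "\<lambda>_. 0" "\<lambda>x. ((P ^^ k) f x)\<^sup>2"] by (simp add: mean_const)
    show "(a (Suc k))\<^sup>2 \<le> a k * a (Suc (Suc k))" for k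
      unfolding a_def by (rule mean_log_convex)
  qed (rule decay)
  also have "a 0 - a 1 \<le> 1"
    unfolding a_def using mean_energy[of f] lip by (simp add: f_def)
  finally show ?thesis
    by (simp add: a_def f_def mult_left_mono)
qed

end

section \<open>The effect of one edge on the random-cluster weight\<close>

lemma equiv_conn: "equiv UNIV (conn A \<eta>)"
proof -
  have "sym ({(u, v). {u, v} \<in> A} \<union> {(u, v). \<exists>B\<in>\<eta>. u \<in> B \<and> v \<in> B})"
    by (auto simp: sym_def insert_commute)
  then show ?thesis
    unfolding conn_def equiv_def by (auto simp: refl_rtrancl trans_rtrancl sym_rtrancl)
qed

lemma conn_mono: "A \<subseteq> B \<Longrightarrow> conn A \<eta> \<subseteq> conn B \<eta>"
  unfolding conn_def by (rule rtrancl_mono) auto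

text \<open>The new edge merges the classes of its endpoints into \<open>M\<close>. As
  \<open>M\<close> is a union of classes, the right-hand side is already transitive.\<close>

lemma conn_insert:
  fixes A \<eta> u v
  defines "M \<equiv> conn A \<eta> `` {u} \<union> conn A \<eta> `` {v}"
  shows "conn (insert {u, v} A) \<eta> = conn A \<eta> \<union> M \<times> M"
proof
  let ?R = "conn A \<eta>" and ?R' = "conn (insert {u, v} A) \<eta>"
  have R: "refl ?R" "sym ?R" "trans ?R" and R': "sym ?R'" "trans ?R'"
    using equiv_conn by (auto simp: equiv_def)
  let ?base = "{(x, y). {x, y} \<in> insert {u, v} A} \<union> {(x, y). \<exists>B\<in>\<eta>. x \<in> B \<and> y \<in> B}"
  have uv: "u \<in> M" "v \<in> M"
    unfolding M_def using reflD[OF R(1)] by blast+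
  have closed: "y \<in> M" if "x \<in> M" "(x, y) \<in> ?R" for x y
    using that R(3) unfolding M_def by (auto dest: transD)
  have closed': "y \<in> M" if "x \<in> M" "(y, x) \<in> ?R" for x y
    using closed that R(2) by (meson symD)
  have trans: "(x, z) \<in> ?R \<union> M \<times> M"
    if "(x, y) \<in> ?R \<union> M \<times> M" "(y, z) \<in> ?R \<union> M \<times> M" for x y z
    using that closed[of y z] closed'[of y x] transD[OF R(3), of x y z] by blast
  have base: "?base \<subseteq> ?R \<union> M \<times> M"
  proof -
    have "{(x, y). {x, y} \<in> A} \<union> {(x, y). \<exists>B\<in>\<eta>. x \<in> B \<and> y \<in> B} \<subseteq> ?R"
      unfolding conn_def by auto
    then show ?thesis using uv by (auto simp: doubleton_eq_iff)
  qed
  show "?R' \<subseteq> ?R \<union> M \<times> M"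
  proof (rule subrelI)
    fix x y assume "(x, y) \<in> ?R'"
    then have "(x, y) \<in> ?base\<^sup>*" by (simp add: conn_def)
    then show "(x, y) \<in> ?R \<union> M \<times> M"
    proof induction
      case base
      show ?case using reflD[OF R(1)] by blast
    next
      case (step y z)
      then show ?case using trans base by blast
    qed
  qed
  have sub: "?R \<subseteq> ?R'" by (rule conn_mono) auto
  have "(u, v) \<in> ?R'" unfolding conn_def by auto
  then have from_u: "(u, y) \<in> ?R'" if "y \<in> M" for y
    using that sub transD[OF R'(2), of u v y] unfolding M_def by blast
  have "(x, y) \<in> ?R'" if "x \<in> M" "y \<in> M" for x y
    using transD[OF R'(2) symD[OF R'(1) from_u[OF that(1)]] from_u[OF that(2)]] .
  then show "?R \<union> M \<times> M \<subseteq> ?R'"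
    using sub by blast
qed

text \<open>Two distinct classes are replaced by the new class \<open>M\<close>, and all others
  survive. The quotient consists of the full classes meeting \<open>S\<close>, which need not lie
  inside \<open>S\<close>.\<close>

lemma card_quotient_merge:
  assumes R: "equiv UNIV R" and fin: "finite S" and uv: "u \<in> S" "v \<in> S" "(u, v) \<notin> R"
  defines "M \<equiv> R `` {u} \<union> R `` {v}"
  shows "card (S // R) = Suc (card (S // (R \<union> M \<times> M)))"
proof -
  have refl: "(x, x) \<in> R" and sym: "(x, y) \<in> R \<Longrightarrow> (y, x) \<in> R"
    and trans: "(x, y) \<in> R \<Longrightarrow> (y, z) \<in> R \<Longrightarrow> (x, z) \<in> R" for x y z
    using R by (auto simp: equiv_def refl_on_def dest: symD transD)
  have cls: "(R \<union> M \<times> M) `` {x} = (if x \<in> M then M else R `` {x})" for x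
    unfolding M_def using trans by auto
  have in_M: "x \<in> M \<longleftrightarrow> R `` {x} = R `` {u} \<or> R `` {x} = R `` {v}" for x
  proof -
    have "(y, x) \<in> R \<longleftrightarrow> R `` {x} = R `` {y}" for y
      using refl sym trans by (metis R UNIV_I equiv_class_eq_iff)
    then show ?thesis unfolding M_def by auto
  qed
  have quot: "S // (R \<union> M \<times> M) = insert M (S // R - {R `` {u}, R `` {v}})"
  proof (intro set_eqI iffI)
    fix Z assume "Z \<in> S // (R \<union> M \<times> M)"
    then obtain x where "x \<in> S" "Z = (R \<union> M \<times> M) `` {x}" by (rule quotientE)
    then show "Z \<in> insert M (S // R - {R `` {u}, R `` {v}})"
      using in_M[of x] cls[of x] by (auto simp: quotientI)
  next
    fix Z assume "Z \<in> insert M (S // R - {R `` {u}, R `` {v}})"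
    then consider "Z = M" | "Z \<in> S // R" "Z \<noteq> R `` {u}" "Z \<noteq> R `` {v}" by blast
    then show "Z \<in> S // (R \<union> M \<times> M)"
    proof cases
      case 1
      then have "Z = (R \<union> M \<times> M) `` {u}" using cls[of u] in_M[of u] by simp
      then show ?thesis using uv(1) by (simp add: quotientI)
    next
      case 2
      then obtain x where "x \<in> S" "Z = R `` {x}" by (auto elim: quotientE)
      with 2 have "Z = (R \<union> M \<times> M) `` {x}" using cls[of x] in_M[of x] by simp
      then show ?thesis using \<open>x \<in> S\<close> by (simp add: quotientI)
    qed
  qed
  have finq: "finite (S // R)"
    using fin by (simp add: quotient_def)
  have ne: "R `` {u} \<noteq> R `` {v}"
    using uv(3) refl by (auto dest: sym)
  have "M \<notin> S // R"
  proof
    assume "M \<in> S // R"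
    then obtain x where "M = R `` {x}" by (rule quotientE)
    then have "(x, u) \<in> R" "(x, v) \<in> R" using refl unfolding M_def by auto
    then show False using uv(3) sym trans by blast
  qed
  then have "card (S // (R \<union> M \<times> M)) = Suc (card (S // R - {R `` {u}, R `` {v}}))"
    unfolding quot using finq by simp
  moreover have "card (S // R - {R `` {u}, R `` {v}}) = card (S // R) - 2"
    using ne uv by (subst card_Diff_subset) (auto simp: quotientI)
  moreover have "card {R `` {u}, R `` {v}} \<le> card (S // R)"
    using finq uv by (intro card_mono) (auto simp: quotientI)
  then have "2 \<le> card (S // R)" using ne by simp
  ultimately show ?thesis by linarith
qed

section \<open>Component counts and edges of the box\<close>

lemma finite_box: "finite (box n)"
  by (simp add: box_def)

lemma ncomp_insert:
  assumes "u \<in> box n" "v \<in> box n"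
  shows "ncomp n A \<eta> = (if (u, v) \<in> conn A \<eta> then 0 else 1) + ncomp n (insert {u, v} A) \<eta>"
proof (cases "(u, v) \<in> conn A \<eta>")
  case True
  let ?R = "conn A \<eta>"
  have "?R `` {u} = ?R `` {v}"
    using True equiv_conn by (metis equiv_class_eq)
  then have "(?R `` {u} \<union> ?R `` {v}) \<times> (?R `` {u} \<union> ?R `` {v}) \<subseteq> ?R"
    using equiv_conn[of A \<eta>] unfolding equiv_def by (auto dest: symD transD)
  then show ?thesis using True by (simp add: ncomp_def conn_insert Un_absorb2)
next
  case False
  then show ?thesis
    using card_quotient_merge[OF equiv_conn finite_box assms False]
    by (simp add: ncomp_def conn_insert)
qed

lemma finite_box_edges: "finite (box_edges n)"
proof (rule finite_subset)
  show "box_edges n \<subseteq> Pow (box n)" by (auto simp: box_edges_def)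
qed (simp add: finite_box)

lemma box_edges_cases:
  assumes "e \<in> box_edges n"
  obtains u v where "e = {u, v}" "u \<in> box n" "v \<in> box n"
  using assms by (auto simp: box_edges_def)

text \<open>The edges in the first coordinate direction suffice; each is determined by its lower
  endpoint.\<close>

lemma card_box_edges_ge: "n * (n - 1) \<le> card (box_edges n)"
proof -
  define h :: "int \<times> int \<Rightarrow> vtx set" where "h = (\<lambda>(i, j). {(i, j), (i + 1, j)})"
  let ?D = "{0..<int n - 1} \<times> {0..<int n}"
  have "inj_on h ?D"
    by (auto simp: inj_on_def h_def doubleton_eq_iff)
  then have "card (h ` ?D) = card ?D" by (simp add: card_image)
  moreover have "h ` ?D \<subseteq> box_edges n"
    unfolding box_edges_def h_def by (force simp: box_def adj_def)
  then have "card (h ` ?D) \<le> card (box_edges n)"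
    by (rule card_mono[OF finite_box_edges])
  moreover have "nat (int n - 1) = n - 1" by linarith
  ultimately show ?thesis by (simp add: card_cartesian_product mult.commute)
qed

text \<open>Edges are unordered; by symmetry of \<open>conn\<close> either orientation may serve as
  witness.\<close>

definition linked :: "vtx set set \<Rightarrow> vtx set set \<Rightarrow> vtx set \<Rightarrow> bool" where
  "linked A \<eta> e \<longleftrightarrow> (\<exists>u v. e = {u, v} \<and> (u, v) \<in> conn A \<eta>)"

lemma linked_iff: "linked A \<eta> {u, v} \<longleftrightarrow> (u, v) \<in> conn A \<eta>"
proof -
  have "sym (conn A \<eta>)" using equiv_conn by (auto simp: equiv_def)
  then show ?thesis unfolding linked_def by (metis doubleton_eq_iff symD)
qed

lemma linked_mono: "A \<subseteq> B \<Longrightarrow> linked A \<eta> e \<Longrightarrow> linked B \<eta> e"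
  unfolding linked_def using conn_mono by blast

section \<open>The Glauber dynamics as a reversible Markov operator\<close>

text \<open>With \<open>2 \<le> n\<close> there are at least two edges, which keeps
  \<open>1 - 2 / m\<close> nonnegative and \<open>1 / m\<close> at most
  \<open>1 / 2\<close>.\<close>

locale random_cluster =
  fixes n :: nat and p q :: real and \<eta> :: "vtx set set"
  assumes n_ge: "2 \<le> n" and p_pos: "0 < p" and p_less: "p < 1" and q_ge: "1 \<le> q"
begin

abbreviation E where "E \<equiv> box_edges n"
abbreviation \<mu> where "\<mu> \<equiv> rc_measure n p q \<eta>"
abbreviation m where "m \<equiv> real (card E)"

text \<open>The opening probability of an edge whose endpoints are not connected otherwise: closing
  it would gain a component and thus a factor \<open>q\<close>.\<close>

definition p_low :: real where
  "p_low = p / (p + q * (1 - p))"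

definition \<theta> :: "vtx set \<Rightarrow> vtx set set \<Rightarrow> real" where
  "\<theta> e A = (if linked (A - {e}) \<eta> e then p else p_low)"

definition P :: "(vtx set set \<Rightarrow> real) \<Rightarrow> vtx set set \<Rightarrow> real" where
  "P g A = (\<Sum>B\<in>Pow E. glauber n p q \<eta> A B * g B)"

lemma card_E_ge: "real n ^ 2 / 2 \<le> m" and card_E_ge_2: "2 \<le> m"
proof -
  have "real (n * (n - 1)) \<le> m"
    using card_box_edges_ge by (simp only: of_nat_le_iff)
  then have *: "real n * (real n - 1) \<le> m"
    using n_ge by (simp add: of_nat_diff)
  have "real n * (n / 2) \<le> real n * (real n - 1)" "2 * 1 \<le> real n * (real n - 1)"
    using n_ge by (intro mult_left_mono mult_mono; simp)+
  with * show "real n ^ 2 / 2 \<le> m" "2 \<le> m"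
    by (simp_all add: power2_eq_square)
qed

lemma p_low_bounds: "0 < p_low" "p_low \<le> p"
proof -
  have "1 * (1 - p) \<le> q * (1 - p)"
    using q_ge p_less by (intro mult_right_mono) auto
  then have "1 \<le> p + q * (1 - p)" by simp
  then show "0 < p_low" "p_low \<le> p"
    unfolding p_low_def using p_pos by (auto simp: divide_le_eq)
qed

lemma \<theta>_bounds: "0 < \<theta> e A" "p_low \<le> \<theta> e A" "\<theta> e A < 1"
  using p_low_bounds p_pos p_less by (auto simp: \<theta>_def)

text \<open>Here \<open>q \<ge> 1\<close> enters, through \<open>p_low \<le> p\<close>. It is the
  basis of the monotone coupling.\<close>

lemma \<theta>_mono: "A \<subseteq> B \<Longrightarrow> \<theta> e A \<le> \<theta> e B"
  using linked_mono[of "A - {e}" "B - {e}" \<eta> e] p_low_bounds by (auto simp: \<theta>_def)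

lemma rc_weight_pos: "0 < rc_weight n p q \<eta> A"
  using p_pos p_less q_ge by (simp add: rc_weight_def)

lemma rc_measure_pos: "0 < \<mu> A"
  unfolding rc_measure_def using finite_box_edges
  by (intro divide_pos_pos rc_weight_pos sum_pos) auto

lemma rc_measure_sum: "sum \<mu> (Pow E) = 1"
proof -
  have "0 < (\<Sum>B\<in>Pow E. rc_weight n p q \<eta> B)"
    using finite_box_edges by (intro sum_pos rc_weight_pos) auto
  then show ?thesis by (simp add: rc_measure_def flip: sum_divide_distrib)
qed

text \<open>The two configurations differ only at \<open>e\<close>, so the partition function and
  the common weight \<open>W\<close> cancel. What remains is \<open>p\<close> against
  \<open>1 - p\<close> times the factor \<open>r\<close>, which is \<open>q\<close> exactly when
  closing \<open>e\<close> splits a component.\<close>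

lemma heat_bath_probability:
  assumes A: "A \<subseteq> E" and e: "e \<in> E"
  shows "\<mu> (A \<union> {e}) / (\<mu> (A \<union> {e}) + \<mu> (A - {e})) = \<theta> e A"
proof -
  obtain u v where uv: "e = {u, v}" "u \<in> box n" "v \<in> box n"
    using e by (rule box_edges_cases)
  define B where "B = A - {e}"
  define Z where "Z = (\<Sum>B\<in>Pow E. rc_weight n p q \<eta> B)"
  have fin: "finite B" and B: "e \<notin> B" "B \<subseteq> E"
    using A finite_box_edges finite_subset by (auto simp: B_def)
  have "insert e (E - insert e B) = E - B" using B e by auto
  moreover have "card (insert e (E - insert e B)) = Suc (card (E - insert e B))"
    by (rule card_insert_disjoint) (simp_all add: finite_box_edges)
  ultimately have closed: "card (E - B) = Suc (card (E - insert e B))" by simp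
  define W where "W = p ^ card B * (1 - p) ^ card (E - insert e B) * q ^ ncomp n (insert e B) \<eta>"
  define r where "r = (if linked B \<eta> e then 1 else q)"
  have "W > 0" unfolding W_def using p_pos p_less q_ge by simp
  have "Z > 0" unfolding Z_def
    using finite_box_edges by (intro sum_pos rc_weight_pos) auto
  have "ncomp n B \<eta> = (if linked B \<eta> e then 0 else 1) + ncomp n (insert e B) \<eta>"
    unfolding uv(1) linked_iff by (rule ncomp_insert[OF uv(2,3)])
  then have b: "\<mu> (A - {e}) = W * ((1 - p) * r) / Z"
    by (simp add: rc_measure_def rc_weight_def closed W_def r_def Z_def flip: B_def)
  have "A \<union> {e} = insert e B" by (auto simp: B_def)
  then have a: "\<mu> (A \<union> {e}) = W * p / Z"
    by (simp add: rc_measure_def rc_weight_def W_def Z_def fin B)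
  have "\<mu> (A \<union> {e}) / (\<mu> (A \<union> {e}) + \<mu> (A - {e})) = (W / Z * p) / (W / Z * (p + (1 - p) * r))"
  proof -
    have "W * p / Z = W / Z * p"
      "W * p / Z + W * ((1 - p) * r) / Z = W / Z * (p + (1 - p) * r)"
      by (simp_all add: distrib_left add_divide_distrib)
    then show ?thesis unfolding a b by (simp only:)
  qed
  also have "\<dots> = p / (p + (1 - p) * r)"
    using \<open>W > 0\<close> \<open>Z > 0\<close> by (subst mult_divide_mult_cancel_left) auto
  also have "\<dots> = \<theta> e A"
    by (simp add: r_def \<theta>_def p_low_def B_def mult.commute)
  finally show ?thesis .
qed

lemma P_eq:
  assumes A: "A \<subseteq> E"
  shows "P g A = (\<Sum>e\<in>E. \<theta> e A * g (insert e A) + (1 - \<theta> e A) * g (A - {e})) / m"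
proof -
  have compl: "\<mu> (A - {e}) / (\<mu> (A \<union> {e}) + \<mu> (A - {e})) = 1 - \<theta> e A" if "e \<in> E" for e
    unfolding heat_bath_probability[OF A that, symmetric]
    using rc_measure_pos[of "A \<union> {e}"] rc_measure_pos[of "A - {e}"] by (simp add: field_simps)
  have glauber_eq: "glauber n p q \<eta> A B = (\<Sum>e\<in>E. (if B = insert e A then \<theta> e A else 0)
      + (if B = A - {e} then 1 - \<theta> e A else 0)) / m" for B
    unfolding glauber_def Let_def
    by (intro arg_cong[where f = "\<lambda>x. x / m"] sum.cong refl)
      (simp only: heat_bath_probability[OF A] compl, simp only: Un_insert_right Un_empty_right)
  have "glauber n p q \<eta> A B * g B = (\<Sum>e\<in>E. (if B = insert e A then \<theta> e A * g B else 0)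
      + (if B = A - {e} then (1 - \<theta> e A) * g B else 0)) / m" for B
    unfolding glauber_eq times_divide_eq_left sum_distrib_right
    by (intro arg_cong[where f = "\<lambda>x. x / m"] sum.cong refl)
      (simp add: distrib_right)
  then have "P g A = (\<Sum>B\<in>Pow E. \<Sum>e\<in>E. (if B = insert e A then \<theta> e A * g B else 0)
      + (if B = A - {e} then (1 - \<theta> e A) * g B else 0)) / m"
    by (simp only: P_def sum_divide_distrib)
  also have "\<dots> = (\<Sum>e\<in>E. \<Sum>B\<in>Pow E. (if B = insert e A then \<theta> e A * g B else 0)
      + (if B = A - {e} then (1 - \<theta> e A) * g B else 0)) / m"
    by (subst sum.swap) simp
  also have "\<dots> = (\<Sum>e\<in>E. \<theta> e A * g (insert e A) + (1 - \<theta> e A) * g (A - {e})) / m"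
  proof (intro arg_cong[where f = "\<lambda>x. x / m"] sum.cong refl)
    fix e assume "e \<in> E"
    then have "insert e A \<in> Pow E" "A - {e} \<in> Pow E" using A by auto
    then show "(\<Sum>B\<in>Pow E. (if B = insert e A then \<theta> e A * g B else 0)
        + (if B = A - {e} then (1 - \<theta> e A) * g B else 0))
      = \<theta> e A * g (insert e A) + (1 - \<theta> e A) * g (A - {e})"
      using finite_box_edges by (simp add: sum.distrib sum.delta)
  qed
  finally show ?thesis .
qed

text \<open>It holds edge by edge. A transition through \<open>e\<close> needs \<open>A\<close> and
  \<open>B\<close> to agree off \<open>e\<close>; its denominator then depends only on that common
  part.\<close>

lemma detailed_balance: "\<mu> A * glauber n p q \<eta> A B = \<mu> B * glauber n p q \<eta> B A"
proof -
  define k where "k A B e = (let a = \<mu> (A \<union> {e}); b = \<mu> (A - {e}) in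
    (if B = A \<union> {e} then a / (a + b) else 0) + (if B = A - {e} then b / (a + b) else 0))" for A B e
  have k: "\<mu> A * k A B e = (if A - {e} = B - {e}
      then \<mu> A * \<mu> B / (\<mu> (A \<union> {e}) + \<mu> (A - {e})) else 0)" for A B e
  proof (cases "A - {e} = B - {e}")
    case True
    then consider "B = A \<union> {e}" "B \<noteq> A - {e}" | "B = A - {e}" "B \<noteq> A \<union> {e}" by blast
    then have "k A B e = \<mu> B / (\<mu> (A \<union> {e}) + \<mu> (A - {e}))"
      by cases (simp_all only: k_def Let_def if_True if_False simp_thms add_0_left add_0_right)
    then show ?thesis by (simp only: True if_True simp_thms times_divide_eq_right)
  next
    case False
    then have "B \<noteq> A \<union> {e}" "B \<noteq> A - {e}" by blast+
    then show ?thesis by (simp only: k_def Let_def False if_False) simp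
  qed
  have "\<mu> A * k A B e = \<mu> B * k B A e" for e
  proof (cases "A - {e} = B - {e}")
    case True
    then have "A \<union> {e} = B \<union> {e}" by blast
    then show ?thesis unfolding k True by (simp add: mult.commute)
  next
    case False
    then have "B - {e} \<noteq> A - {e}" by blast
    then show ?thesis using False by (simp only: k if_False)
  qed
  then show ?thesis
    unfolding glauber_def k_def[symmetric] times_divide_eq_right sum_distrib_left by simp
qed

lemma markov_operator_P: "markov_operator (Pow E) P"
proof
  show "P (\<lambda>x. a * f x + b * g x) = (\<lambda>x. a * P f x + b * P g x)" for a b f g
    by (rule ext) (simp add: P_def sum.distrib sum_distrib_left algebra_simps)
  show "P f A \<le> P g A" if "\<And>B. B \<in> Pow E \<Longrightarrow> f B \<le> g B" "A \<in> Pow E" for f g A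
  proof -
    have "insert e A \<in> Pow E" "A - {e} \<in> Pow E" if "e \<in> E" for e
      using \<open>A \<in> Pow E\<close> that by auto
    then show ?thesis
      using that \<theta>_bounds
      by (auto simp: P_eq less_imp_le simp del: Pow_iff
          intro!: divide_right_mono sum_mono add_mono mult_left_mono)
  qed
  show "P (\<lambda>_. c) A = c" if "A \<in> Pow E" for A c
    using that card_E_ge_2 by (simp add: P_eq flip: distrib_right)
qed

end

sublocale random_cluster \<subseteq> reversible_operator "Pow E" P \<mu>
proof (intro reversible_operator.intro markov_operator_P reversible_operator_axioms.intro)
  fix f g
  have "(\<Sum>A\<in>Pow E. \<mu> A * (P f A * g A))
      = (\<Sum>A\<in>Pow E. \<Sum>B\<in>Pow E. (\<mu> A * glauber n p q \<eta> A B) * f B * g A)"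
    by (simp add: P_def sum_distrib_left sum_distrib_right mult.assoc)
  also have "\<dots> = (\<Sum>B\<in>Pow E. \<Sum>A\<in>Pow E. (\<mu> B * glauber n p q \<eta> B A) * f B * g A)"
    by (subst sum.swap) (simp add: detailed_balance)
  also have "\<dots> = (\<Sum>A\<in>Pow E. \<mu> A * (f A * P g A))"
    by (simp add: P_def sum_distrib_left mult_ac)
  finally show "(\<Sum>A\<in>Pow E. \<mu> A * (P f A * g A)) = (\<Sum>A\<in>Pow E. \<mu> A * (f A * P g A))" .
qed (use rc_measure_pos rc_measure_sum finite_box_edges in \<open>auto intro: less_imp_le\<close>)

section \<open>Convergence to equilibrium and the mixing time\<close>

context random_cluster
begin

lemma P_ge_closing:
  assumes A: "A \<subseteq> E" and e: "e \<in> E" and g: "\<And>B. B \<subseteq> E \<Longrightarrow> 0 \<le> g B"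
  shows "(1 - \<theta> e A) * g (A - {e}) / m \<le> P g A"
proof -
  have nn: "0 \<le> \<theta> e A * g (insert e A)" "0 \<le> (1 - \<theta> e A) * g (A - {e})" if "e \<in> E" for e
    using \<theta>_bounds[of e A] that A by (auto intro!: mult_nonneg_nonneg g)
  have "(1 - \<theta> e A) * g (A - {e}) \<le> \<theta> e A * g (insert e A) + (1 - \<theta> e A) * g (A - {e})"
    using nn[OF e] by simp
  also have "\<dots> \<le> (\<Sum>e\<in>E. \<theta> e A * g (insert e A) + (1 - \<theta> e A) * g (A - {e}))"
    by (rule member_le_sum[OF e]) (use nn finite_box_edges in auto)
  finally show ?thesis
    unfolding P_eq[OF A] by (rule divide_right_mono) simp
qed

text \<open>Open edges are closed one at a time, and surplus steps reclose a closed edge. Hence the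
  exponent \<open>card E\<close> serves every start, as the Doeblin argument requires.\<close>

lemma reach_empty:
  assumes "A \<subseteq> E" "card A \<le> k"
  shows "0 < (P ^^ k) (\<lambda>B. if B = {} then 1 else 0) A"
  using assms
proof (induction k arbitrary: A)
  case 0
  then show ?case using finite_box_edges finite_subset by fastforce
next
  case (Suc k)
  let ?g = "(P ^^ k) (\<lambda>B. if B = {} then 1 else 0)"
  interpret Pk: markov_operator "Pow E" "P ^^ k"
    by (rule markov_operator_funpow)
  have finA: "finite A" using Suc.prems finite_box_edges finite_subset by blast
  have "E \<noteq> {}" using card_E_ge_2 by auto
  obtain e where e: "e \<in> E" "card (A - {e}) \<le> k"
  proof (cases "A = {}")
    case True
    then show ?thesis using that \<open>E \<noteq> {}\<close> by auto
  next
    case False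
    then obtain e where "e \<in> A" by blast
    then show ?thesis using that[of e] Suc.prems finA by (auto simp: card_Diff_singleton)
  qed
  then have "0 < ?g (A - {e})"
    using Suc by blast
  then have "0 < (1 - \<theta> e A) * ?g (A - {e}) / m"
    using \<theta>_bounds(3)[of e A] card_E_ge_2 by simp
  also have "\<dots> \<le> P ?g A"
    using Suc.prems e by (intro P_ge_closing Pk.nonneg) auto
  finally show ?case by simp
qed

text \<open>The evolution of laws is adjoint to the evolution of observables.\<close>

lemma sum_dist_step_funpow:
  "(\<Sum>B\<in>Pow E. (dist_step n p q \<eta> ^^ t) d B * g B) = (\<Sum>A\<in>Pow E. d A * (P ^^ t) g A)"
proof (induction t arbitrary: g)
  case (Suc t)
  have "(\<Sum>B\<in>Pow E. (dist_step n p q \<eta> ^^ Suc t) d B * g B)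
      = (\<Sum>B\<in>Pow E. \<Sum>A\<in>Pow E. (dist_step n p q \<eta> ^^ t) d A * glauber n p q \<eta> A B * g B)"
    by (simp add: dist_step_def sum_distrib_right)
  also have "\<dots> = (\<Sum>A\<in>Pow E. (dist_step n p q \<eta> ^^ t) d A * P g A)"
    by (subst sum.swap) (simp add: P_def sum_distrib_left mult.assoc)
  also have "\<dots> = (\<Sum>A\<in>Pow E. d A * (P ^^ Suc t) g A)"
    by (simp add: Suc.IH funpow_swap1)
  finally show ?case .
qed simp

lemma sum_dist_at:
  assumes "X \<in> Pow E"
  shows "(\<Sum>B\<in>Pow E. dist_at n p q \<eta> X t B * g B) = (P ^^ t) g X"
proof -
  have "(\<Sum>B\<in>Pow E. (if B = X then 1 else 0) * (P ^^ t) g B)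
      = (\<Sum>B\<in>Pow E. if B = X then (P ^^ t) g B else 0)"
    by (rule sum.cong) auto
  then show ?thesis
    unfolding dist_at_def sum_dist_step_funpow
    using assms finite_box_edges by simp
qed

text \<open>The sign of the difference \<open>D\<close> of the two laws is the test function that
  attains the dual norm.\<close>

lemma tv_dist_iff_mixed:
  assumes X: "X \<in> Pow E"
  shows "tv_dist n (dist_at n p q \<eta> X t) \<mu> \<le> 1 / 4 \<longleftrightarrow> mixed t X"
proof -
  define D where "D B = dist_at n p q \<eta> X t B - \<mu> B" for B
  have D: "(P ^^ t) g X - mean g = (\<Sum>B\<in>Pow E. D B * g B)" for g
    unfolding sum_dist_at[OF X, symmetric] mean_def D_def by (simp add: left_diff_distrib sum_subtractf)
  have tv: "tv_dist n (dist_at n p q \<eta> X t) \<mu> \<le> 1 / 4 \<longleftrightarrow> (\<Sum>B\<in>Pow E. \<bar>D B\<bar>) \<le> 1 / 2"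
    by (simp add: tv_dist_def D_def mult.commute)
  show ?thesis
    unfolding tv
  proof
    assume *: "(\<Sum>B\<in>Pow E. \<bar>D B\<bar>) \<le> 1 / 2"
    show "mixed t X"
      unfolding mixed_def D
    proof (intro allI impI)
      fix g :: "vtx set set \<Rightarrow> real" assume g: "\<forall>y\<in>Pow E. \<bar>g y\<bar> \<le> 1"
      have "\<bar>\<Sum>B\<in>Pow E. D B * g B\<bar> \<le> (\<Sum>B\<in>Pow E. \<bar>D B * g B\<bar>)" by (rule sum_abs)
      also have "\<dots> \<le> (\<Sum>B\<in>Pow E. \<bar>D B\<bar>)"
        using g by (intro sum_mono) (auto simp: abs_mult mult_left_le)
      finally show "\<bar>\<Sum>B\<in>Pow E. D B * g B\<bar> \<le> 1 / 2" using * by simp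
    qed
  next
    assume "mixed t X"
    then have "\<bar>\<Sum>B\<in>Pow E. D B * sgn (D B)\<bar> \<le> 1 / 2"
      unfolding mixed_def D by (auto simp: sgn_if)
    then show "(\<Sum>B\<in>Pow E. \<bar>D B\<bar>) \<le> 1 / 2"
      by (simp flip: abs_sgn)
  qed
qed

text \<open>Some mixed time exists, so each \<open>LEAST\<close> is attained; monotonicity in time
  then passes to the maximum.\<close>

lemma mixed_mixing_time:
  assumes X: "X \<in> Pow E"
  shows "mixed (mixing_time n p q \<eta>) X"
proof -
  let ?L = "\<lambda>X. LEAST t. tv_dist n (dist_at n p q \<eta> X t) \<mu> \<le> 1 / 4"
  have "\<exists>t. \<forall>X\<in>Pow E. mixed t X"
  proof (rule eventually_mixed[of "{}" "card E"])
    show "0 < (P ^^ card E) (\<lambda>B. if B = {} then 1 else 0) A" if "A \<in> Pow E" for A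
      using that by (intro reach_empty card_mono finite_box_edges) auto
  qed simp
  then have "\<exists>t. tv_dist n (dist_at n p q \<eta> X t) \<mu> \<le> 1 / 4"
    using X tv_dist_iff_mixed[OF X] by blast
  then have "mixed (?L X) X"
    unfolding tv_dist_iff_mixed[OF X, symmetric] by (rule LeastI_ex)
  moreover have "?L X \<le> mixing_time n p q \<eta>"
    unfolding mixing_time_def using X finite_box_edges by (intro Max_ge) auto
  ultimately show ?thesis by (rule mixed_mono)
qed

section \<open>The number of open edges: step size and mean\<close>

definition F :: "vtx set set \<Rightarrow> real" where
  "F A = real (card A)"

lemma F_insert_Diff:
  assumes "A \<subseteq> E"
  shows "F (insert e A) = F (A - {e}) + 1" "F (A - {e}) = F A - (if e \<in> A then 1 else 0)"
proof -
  have fin: "finite A" using assms finite_box_edges finite_subset by blast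
  then show "F (insert e A) = F (A - {e}) + 1"
    by (simp add: F_def card.insert_remove)
  show "F (A - {e}) = F A - (if e \<in> A then 1 else 0)"
  proof (cases "e \<in> A")
    case True
    then have "card A = Suc (card (A - {e}))" using fin by (metis card_Suc_Diff1)
    then show ?thesis using True by (simp add: F_def)
  qed (simp add: F_def)
qed

lemma F_step_le:
  assumes "A \<in> Pow E"
  shows "P (\<lambda>B. (F B - F A)\<^sup>2) A \<le> 1"
proof -
  have A: "A \<subseteq> E" using assms by simp
  have "P (\<lambda>B. (F B - F A)\<^sup>2) A \<le> (\<Sum>e\<in>E. \<theta> e A * 1 + (1 - \<theta> e A) * 1) / m"
    unfolding P_eq[OF A] F_insert_Diff[OF A]
    using \<theta>_bounds by (intro divide_right_mono sum_mono add_mono mult_left_mono) (auto simp: less_imp_le)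
  also have "\<dots> = 1" using card_E_ge_2 by simp
  finally show ?thesis .
qed

text \<open>An update forgets the chosen edge, at an expected loss of \<open>F A / m\<close>, and
  opens it with probability at least \<open>p_low\<close>. In equilibrium loss and gain
  balance.\<close>

lemma mean_F_ge: "p_low * m \<le> mean F"
proof -
  have PF: "(1 - 1 / m) * F A + p_low \<le> P F A" if "A \<in> Pow E" for A
  proof -
    have A: "A \<subseteq> E" using that by simp
    have "(\<Sum>e\<in>E. if e \<in> A then 1 else 0 :: real) = F A"
      using A finite_box_edges by (simp add: F_def sum.If_cases Int_absorb1)
    then have "m * F A - F A + m * p_low = (\<Sum>e\<in>E. F A - (if e \<in> A then 1 else 0) + p_low)"
      by (simp add: sum.distrib sum_subtractf)
    also have "\<dots> \<le> (\<Sum>e\<in>E. \<theta> e A * F (insert e A) + (1 - \<theta> e A) * F (A - {e}))"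
    proof (rule sum_mono)
      fix e
      have "\<theta> e A * F (insert e A) + (1 - \<theta> e A) * F (A - {e}) = F (A - {e}) + \<theta> e A"
        unfolding F_insert_Diff(1)[OF A] by (simp add: algebra_simps)
      then show "F A - (if e \<in> A then 1 else 0) + p_low
          \<le> \<theta> e A * F (insert e A) + (1 - \<theta> e A) * F (A - {e})"
        using \<theta>_bounds(2)[of e A] F_insert_Diff(2)[OF A, of e] by linarith
    qed
    finally have "(m * F A - F A + m * p_low) / m \<le> P F A"
      unfolding P_eq[OF A] by (rule divide_right_mono) simp
    moreover have "(m * F A - F A + m * p_low) / m = (1 - 1 / m) * F A + p_low"
      using card_E_ge_2 by (simp add: field_simps)
    ultimately show ?thesis by simp
  qed
  have "mean (\<lambda>A. (1 - 1 / m) * F A + p_low) \<le> mean (P F)"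
    by (rule mean_mono) (rule PF)
  then have "(1 - 1 / m) * mean F + p_low \<le> mean F"
    by (simp only: mean_add mean_scale mean_const mean_stationary)
  then show ?thesis using card_E_ge_2 by (simp add: field_simps)
qed

end

section \<open>The monotone coupling and the untouched edges\<close>

context random_cluster
begin

text \<open>The components of a state are the dynamics from the empty configuration, the dynamics
  from \<open>Y0\<close>, and the set of edges not updated so far.\<close>

fun Q :: "(vtx set set \<times> vtx set set \<times> vtx set set \<Rightarrow> real) \<Rightarrow>
    vtx set set \<times> vtx set set \<times> vtx set set \<Rightarrow> real" where
  "Q h (X, Y, U) = (\<Sum>e\<in>E. \<theta> e X * h (insert e X, insert e Y, U - {e})
     + (\<theta> e Y - \<theta> e X) * h (X - {e}, insert e Y, U - {e})
     + (1 - \<theta> e Y) * h (X - {e}, Y - {e}, U - {e})) / m"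

text \<open>The invariants of the coupling, used as its state space: the order of the two chains,
  and the fact that untouched edges are closed in \<open>X\<close> and keep their initial state in
  \<open>Y\<close>.\<close>

definition coupled :: "vtx set set \<Rightarrow> (vtx set set \<times> vtx set set \<times> vtx set set) set" where
  "coupled Y0 = {(X, Y, U). X \<subseteq> Y \<and> Y \<subseteq> E \<and> U \<subseteq> E \<and> U \<inter> X = {} \<and> U \<inter> Y = U \<inter> Y0}"

text \<open>The weight \<open>\<theta> e Y - \<theta> e X\<close> is nonnegative because
  \<open>X \<subseteq> Y\<close> on coupled states.\<close>

lemma markov_operator_Q: "markov_operator (coupled Y0) Q"
proof
  show "Q (\<lambda>x. a * f x + b * g x) = (\<lambda>x. a * Q f x + b * Q g x)" for a b f g
  proof
    fix s show "Q (\<lambda>x. a * f x + b * g x) s = a * Q f s + b * Q g s"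
      by (cases s) (simp add: sum_distrib_left sum_divide_distrib flip: sum.distrib,
          simp add: algebra_simps add_divide_distrib diff_divide_distrib)
  qed
  show "Q f s \<le> Q g s" if le: "\<And>s. s \<in> coupled Y0 \<Longrightarrow> f s \<le> g s" and "s \<in> coupled Y0" for f g s
  proof -
    obtain X Y U where s: "s = (X, Y, U)" by (cases s)
    have XY: "X \<subseteq> Y" using that(2) by (auto simp: s coupled_def)
    have "(insert e X, insert e Y, U - {e}) \<in> coupled Y0 \<and>
        (X - {e}, insert e Y, U - {e}) \<in> coupled Y0 \<and>
        (X - {e}, Y - {e}, U - {e}) \<in> coupled Y0" if "e \<in> E" for e
      using \<open>s \<in> coupled Y0\<close> that unfolding s coupled_def by blast
    then show ?thesis
      unfolding s Q.simps using \<theta>_bounds \<theta>_mono[OF XY] le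
      by (intro divide_right_mono sum_mono add_mono mult_left_mono) (auto simp: less_imp_le)
  qed
  show "Q (\<lambda>_. c) s = c" if "s \<in> coupled Y0" for s c
    using card_E_ge_2 by (cases s) (simp flip: distrib_right)
qed

text \<open>The last two weights, both closing \<open>e\<close> in \<open>X\<close>, add up to
  \<open>1 - \<theta> e X\<close>.\<close>

lemma Q_fst:
  assumes "s \<in> coupled Y0"
  shows "Q (\<lambda>s. g (fst s)) s = P g (fst s)"
proof -
  obtain X Y U where s: "s = (X, Y, U)" by (cases s)
  have X: "X \<subseteq> E" using assms by (auto simp: s coupled_def)
  show ?thesis
    unfolding s Q.simps fst_conv P_eq[OF X]
    by (intro arg_cong[where f = "\<lambda>x. x / m"] sum.cong refl) (simp add: algebra_simps)
qed

text \<open>The first two weights, both opening \<open>e\<close> in \<open>Y\<close>, add up to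
  \<open>\<theta> e Y\<close>.\<close>

lemma Q_fst_snd:
  assumes "s \<in> coupled Y0"
  shows "Q (\<lambda>s. g (fst (snd s))) s = P g (fst (snd s))"
proof -
  obtain X Y U where s: "s = (X, Y, U)" by (cases s)
  have Y: "Y \<subseteq> E" using assms by (auto simp: s coupled_def)
  show ?thesis
    unfolding s Q.simps fst_conv snd_conv P_eq[OF Y]
    by (intro arg_cong[where f = "\<lambda>x. x / m"] sum.cong refl) (simp add: algebra_simps)
qed

definition untouched :: "vtx set set \<Rightarrow> vtx set set \<times> vtx set set \<times> vtx set set \<Rightarrow> real" where
  "untouched Y0 s = real (card (snd (snd s) \<inter> Y0))"

text \<open>The count of untouched edges of \<open>Y0\<close> is a pure death chain: from value
  \<open>N\<close> it drops by one with probability \<open>N / m\<close>, whatever the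
  configurations are.\<close>

lemma Q_untouched_function:
  fixes \<phi> :: "real \<Rightarrow> real"
  assumes "s \<in> coupled Y0"
  shows "Q (\<lambda>s. \<phi> (untouched Y0 s)) s
    = \<phi> (untouched Y0 s) - untouched Y0 s / m * (\<phi> (untouched Y0 s) - \<phi> (untouched Y0 s - 1))"
proof -
  obtain X Y U where s: "s = (X, Y, U)" by (cases s)
  define V where "V = U \<inter> Y0"
  have V: "V \<subseteq> E" "finite V"
    using assms finite_box_edges by (auto simp: s coupled_def V_def intro: finite_subset)
  let ?N = "real (card V)"
  have card_V: "real (card ((U - {e}) \<inter> Y0)) = ?N - (if e \<in> V then 1 else 0)" for e
  proof -
    have "(U - {e}) \<inter> Y0 = V - {e}" by (auto simp: V_def)
    then show ?thesis using F_insert_Diff(2)[OF V(1), of e] by (simp only: F_def)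
  qed
  have "Q (\<lambda>s. \<phi> (untouched Y0 s)) s = (\<Sum>e\<in>E. \<phi> (real (card ((U - {e}) \<inter> Y0)))) / m"
    unfolding s Q.simps untouched_def
    by (intro arg_cong[where f = "\<lambda>x. x / m"] sum.cong refl) (simp add: algebra_simps)
  also have "(\<Sum>e\<in>E. \<phi> (real (card ((U - {e}) \<inter> Y0))))
      = (\<Sum>e\<in>E. \<phi> ?N - (if e \<in> V then \<phi> ?N - \<phi> (?N - 1) else 0))"
    unfolding card_V by (rule sum.cong) auto
  also have "\<dots> = m * \<phi> ?N - ?N * (\<phi> ?N - \<phi> (?N - 1))"
    using V finite_box_edges by (simp add: sum_subtractf sum.If_cases Int_absorb1)
  also have "\<dots> / m = \<phi> ?N - ?N / m * (\<phi> ?N - \<phi> (?N - 1))"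
    using card_E_ge_2 by (simp add: field_simps)
  finally show ?thesis by (simp add: s untouched_def V_def)
qed

text \<open>For the count \<open>N\<close>, both \<open>N\<close> and \<open>N * (N - 1)\<close> are
  eigenfunctions, with eigenvalues \<open>1 - 1 / m\<close> and \<open>1 - 2 / m\<close>. Since
  \<open>1 - 2 / m \<le> (1 - 1 / m) ^ 2\<close>, the variance is at most the mean.\<close>

lemma untouched_second_moment:
  fixes T :: nat and Y0 :: "vtx set set"
  assumes Y0: "Y0 \<subseteq> E"
  defines "\<alpha> \<equiv> (1 - 1 / m) ^ T"
  shows "(Q ^^ T) (\<lambda>s. (untouched Y0 s - \<alpha> * F Y0)\<^sup>2) ({}, Y0, E) \<le> \<alpha> * F Y0"
proof -
  let ?N = "untouched Y0" and ?s = "({}, Y0, E)"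
  interpret Q: markov_operator "coupled Y0" Q by (rule markov_operator_Q)
  interpret QT: markov_operator "coupled Y0" "Q ^^ T" by (rule Q.markov_operator_funpow)
  have s: "?s \<in> coupled Y0" using Y0 by (auto simp: coupled_def)
  have N0: "?N ?s = F Y0" using Y0 by (simp add: untouched_def F_def Int_absorb1)
  have "Q ?N s = (1 - 1 / m) * ?N s" if "s \<in> coupled Y0" for s
    using Q_untouched_function[OF that, of "\<lambda>x. x"] by (simp add: algebra_simps)
  then have N: "(Q ^^ T) ?N ?s = \<alpha> * F Y0"
    unfolding \<alpha>_def N0[symmetric] by (rule Q.eigenfunction_funpow[OF _ s])
  have "Q (\<lambda>s. ?N s * (?N s - 1)) s = (1 - 2 / m) * (?N s * (?N s - 1))" if "s \<in> coupled Y0" for s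
    using Q_untouched_function[OF that, of "\<lambda>x. x * (x - 1)"] by (simp add: algebra_simps)
  then have G: "(Q ^^ T) (\<lambda>s. ?N s * (?N s - 1)) ?s = (1 - 2 / m) ^ T * (F Y0 * (F Y0 - 1))"
    unfolding N0[symmetric] by (rule Q.eigenfunction_funpow[OF _ s])
  have "1 - 2 / m \<le> (1 - 1 / m)\<^sup>2"
    by (simp add: power2_eq_square algebra_simps)
  then have "(1 - 2 / m) ^ T \<le> ((1 - 1 / m)\<^sup>2) ^ T"
    using card_E_ge_2 by (intro power_mono) (auto simp: field_simps)
  then have le: "(1 - 2 / m) ^ T \<le> \<alpha>\<^sup>2"
    unfolding \<alpha>_def by (simp add: mult.commute flip: power_mult)
  have F: "0 \<le> F Y0 * (F Y0 - 1)" "0 \<le> F Y0"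
    unfolding F_def by (cases "card Y0"; simp)+
  \<comment> \<open>The square is expanded in the eigenfunctions \<open>N * (N - 1)\<close>,
    \<open>N\<close> and 1.\<close>
  have "(Q ^^ T) (\<lambda>s. (?N s - \<alpha> * F Y0)\<^sup>2) ?s
      = (Q ^^ T) (\<lambda>s. ?N s * (?N s - 1) + ((1 - 2 * \<alpha> * F Y0) * ?N s + (\<alpha> * F Y0)\<^sup>2)) ?s"
    by (rule arg_cong[where f = "\<lambda>h. (Q ^^ T) h ?s"]) (auto simp: power2_eq_square algebra_simps)
  also have "\<dots> = (1 - 2 / m) ^ T * (F Y0 * (F Y0 - 1))
      + ((1 - 2 * \<alpha> * F Y0) * (\<alpha> * F Y0) + (\<alpha> * F Y0)\<^sup>2)"
    by (simp only: QT.add QT.scale QT.const[OF s] N G)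
  also have "\<dots> \<le> \<alpha>\<^sup>2 * (F Y0 * (F Y0 - 1))
      + ((1 - 2 * \<alpha> * F Y0) * (\<alpha> * F Y0) + (\<alpha> * F Y0)\<^sup>2)"
    using le F(1) by (intro add_right_mono mult_right_mono)
  also have "\<dots> = \<alpha> * F Y0 - \<alpha>\<^sup>2 * F Y0"
    by (simp add: power2_eq_square algebra_simps)
  also have "\<dots> \<le> \<alpha> * F Y0" using F(2) by simp
  finally show ?thesis .
qed

text \<open>The untouched edges of \<open>Y0\<close> are open in \<open>Y\<close> and closed in
  \<open>X\<close>, so \<open>Y\<close> contains them disjointly from \<open>X\<close>.\<close>

lemma coupled_F_le:
  assumes "s \<in> coupled Y0"
  shows "F (fst s) \<le> F (fst (snd s)) - untouched Y0 s"
proof -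
  obtain X Y U where s: "s = (X, Y, U)" by (cases s)
  have *: "X \<subseteq> Y" "Y \<subseteq> E" "X \<inter> (U \<inter> Y0) = {}" "U \<inter> Y0 \<subseteq> Y"
    using assms by (auto simp: s coupled_def)
  have fin: "finite Y" using * finite_box_edges finite_subset by blast
  then have "finite X" "finite (U \<inter> Y0)" using * finite_subset by blast+
  then have "card X + card (U \<inter> Y0) = card (X \<union> (U \<inter> Y0))"
    using * by (simp add: card_Un_disjoint)
  also have "\<dots> \<le> card Y" using * fin by (intro card_mono) auto
  finally show ?thesis by (simp add: s F_def untouched_def flip: of_nat_add)
qed

text \<open>The gap between the two sides is the sum of the squares of \<open>a + b\<close>,
  \<open>a + c\<close> and \<open>b - c\<close>.\<close>

lemma square_sum3_le: "(a - b - c)\<^sup>2 \<le> 3 * (a\<^sup>2 + b\<^sup>2 + c\<^sup>2)" for a b c :: real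
  using zero_le_power2[of "a + b"] zero_le_power2[of "a + c"] zero_le_power2[of "b - c"]
  by (simp add: power2_eq_square algebra_simps)

text \<open>With \<open>N\<close> the number of untouched edges of \<open>Y0\<close>, the inequality \<open>F X \<le> F Y - N\<close> shows that
  \<open>F X > mean F - L / 2\<close> forces one of \<open>F Y - mean F\<close>, \<open>N - \<alpha> * F Y0\<close> and
  \<open>\<alpha> * (F Y0 - mean F)\<close> to be of order \<open>L\<close>.\<close>

lemma coupling_Chebyshev:
  fixes T :: nat
  defines "\<alpha> \<equiv> (1 - 1 / m) ^ T"
  defines "L \<equiv> \<alpha> * mean F" and "Var \<equiv> mean (\<lambda>A. (F A - mean F)\<^sup>2)"
  assumes L: "L > 0"
  shows "(P ^^ T) (\<lambda>A. if mean F - L / 2 < F A then 1 else 0) {} \<le> 12 / L\<^sup>2 * (2 * Var + L)"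
proof -
  let ?\<psi> = "\<lambda>A. if mean F - L / 2 < F A then 1 else (0::real)"
  have \<alpha>: "0 \<le> \<alpha>" "\<alpha> \<le> 1"
    unfolding \<alpha>_def using card_E_ge_2 by (auto intro!: power_le_one)
  have bound: "(P ^^ T) ?\<psi> {} \<le> 12 / L\<^sup>2 * ((P ^^ T) (\<lambda>A. (F A - mean F)\<^sup>2) Y0
      + (\<alpha> * F Y0 + \<alpha>\<^sup>2 * (F Y0 - mean F)\<^sup>2))" if "Y0 \<in> Pow E" for Y0
  proof -
    have Y0: "Y0 \<subseteq> E" using that by simp
    let ?s = "({}, Y0, E)"
    interpret Q: markov_operator "coupled Y0" Q by (rule markov_operator_Q)
    interpret QT: markov_operator "coupled Y0" "Q ^^ T" by (rule Q.markov_operator_funpow)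
    have s: "?s \<in> coupled Y0" using Y0 by (auto simp: coupled_def)
    define c where "c = \<alpha>\<^sup>2 * (F Y0 - mean F)\<^sup>2"
    have pointwise: "?\<psi> (fst s) \<le> 12 / L\<^sup>2 * ((F (fst (snd s)) - mean F)\<^sup>2
        + ((untouched Y0 s - \<alpha> * F Y0)\<^sup>2 + c))" if "s \<in> coupled Y0" for s
    proof (cases "mean F - L / 2 < F (fst s)")
      case True
      let ?a = "F (fst (snd s)) - mean F" and ?b = "untouched Y0 s - \<alpha> * F Y0"
        and ?c = "\<alpha> * (F Y0 - mean F)"
      have "L / 2 \<le> ?a - ?b - ?c"
        using True coupled_F_le[OF that] by (simp add: L_def algebra_simps)
      then have "(L / 2)\<^sup>2 \<le> (?a - ?b - ?c)\<^sup>2" using L by (intro power_mono) auto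
      also have "\<dots> \<le> 3 * (?a\<^sup>2 + ?b\<^sup>2 + ?c\<^sup>2)" by (rule square_sum3_le)
      finally have "L\<^sup>2 \<le> 12 * (?a\<^sup>2 + (?b\<^sup>2 + c))"
        by (simp add: c_def power_mult_distrib power_divide)
      then show ?thesis using True L by (simp add: field_simps)
    next
      case False
      then show ?thesis by (simp add: c_def)
    qed
    have "(P ^^ T) ?\<psi> {} = (Q ^^ T) (\<lambda>s. ?\<psi> (fst s)) ?s"
      using funpow_projection[OF Q.markov_operator_axioms markov_operator_P Q_fst s, where t = T and g = ?\<psi>] by simp
    also have "\<dots> \<le> (Q ^^ T) (\<lambda>s. 12 / L\<^sup>2 * ((F (fst (snd s)) - mean F)\<^sup>2
        + ((untouched Y0 s - \<alpha> * F Y0)\<^sup>2 + c))) ?s"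
      by (rule QT.mono[OF pointwise s])
    also have "\<dots> = 12 / L\<^sup>2 * ((Q ^^ T) (\<lambda>s. (F (fst (snd s)) - mean F)\<^sup>2) ?s
        + ((Q ^^ T) (\<lambda>s. (untouched Y0 s - \<alpha> * F Y0)\<^sup>2) ?s + c))"
      by (simp only: QT.add QT.scale QT.const[OF s])
    also have "(Q ^^ T) (\<lambda>s. (F (fst (snd s)) - mean F)\<^sup>2) ?s = (P ^^ T) (\<lambda>A. (F A - mean F)\<^sup>2) Y0"
      using funpow_projection[OF Q.markov_operator_axioms markov_operator_P Q_fst_snd s,
          where t = T and g = "\<lambda>A. (F A - mean F)\<^sup>2"] by simp
    also have "12 / L\<^sup>2 * ((P ^^ T) (\<lambda>A. (F A - mean F)\<^sup>2) Y0
        + ((Q ^^ T) (\<lambda>s. (untouched Y0 s - \<alpha> * F Y0)\<^sup>2) ?s + c))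
      \<le> 12 / L\<^sup>2 * ((P ^^ T) (\<lambda>A. (F A - mean F)\<^sup>2) Y0 + (\<alpha> * F Y0 + c))"
      using untouched_second_moment[OF Y0, of T] unfolding \<alpha>_def
      by (intro mult_left_mono add_left_mono add_right_mono) auto
    finally show ?thesis unfolding c_def .
  qed
  \<comment> \<open>The left side does not involve \<open>Y0\<close>, so the bound may be averaged
    over a stationary \<open>Y0\<close>; stationarity turns the first term into
    \<open>Var\<close>.\<close>
  have "(P ^^ T) ?\<psi> {} = mean (\<lambda>_. (P ^^ T) ?\<psi> {})" by (simp only: mean_const)
  also have "\<dots> \<le> mean (\<lambda>Y0. 12 / L\<^sup>2 * ((P ^^ T) (\<lambda>A. (F A - mean F)\<^sup>2) Y0
      + (\<alpha> * F Y0 + \<alpha>\<^sup>2 * (F Y0 - mean F)\<^sup>2)))"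
    by (rule mean_mono) (rule bound)
  also have "\<dots> = 12 / L\<^sup>2 * (Var + (L + \<alpha>\<^sup>2 * Var))"
    by (simp only: mean_add mean_scale mean_stationary_funpow Var_def L_def)
  also have "\<dots> \<le> 12 / L\<^sup>2 * (2 * Var + L)"
  proof (rule mult_left_mono)
    have "0 \<le> Var"
      unfolding Var_def using mean_mono[of "\<lambda>_. 0" "\<lambda>A. (F A - mean F)\<^sup>2"] by (simp add: mean_const)
    then have "\<alpha>\<^sup>2 * Var \<le> 1 * Var"
      using \<alpha> by (intro mult_right_mono) (auto simp: power_le_one)
    then show "Var + (L + \<alpha>\<^sup>2 * Var) \<le> 2 * Var + L" by simp
  qed simp
  finally show ?thesis .
qed

text \<open>The event \<open>F > mean F - L / 2\<close> is likely in equilibrium by Chebyshev's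
  inequality and unlikely from the empty start by the coupling, while mixing allows a gap of at most
  \<open>1 / 2\<close>.\<close>

lemma mixed_imp_bound:
  fixes T :: nat
  defines "L \<equiv> (1 - 1 / m) ^ T * mean F"
  assumes mixed: "\<And>A. A \<in> Pow E \<Longrightarrow> mixed T A" and L: "L > 0"
  shows "1 / 2 \<le> 12 / L + 112 / 3 * real T / L\<^sup>2"
proof -
  define Var where "Var = mean (\<lambda>A. (F A - mean F)\<^sup>2)"
  let ?\<psi> = "\<lambda>A. if mean F - L / 2 < F A then 1 else (0::real)"
  have Var: "Var \<le> 4 / 3 * real T"
    unfolding Var_def using mixed F_step_le by (rule variance_le_mixing_time)
  have "(P ^^ T) ?\<psi> {} \<le> 12 / L\<^sup>2 * (2 * Var + L)"
    unfolding Var_def L_def by (rule coupling_Chebyshev) (use L in \<open>simp add: L_def\<close>)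
  moreover have "mean (\<lambda>A. 1 - 4 / L\<^sup>2 * (F A - mean F)\<^sup>2) \<le> mean ?\<psi>"
  proof (rule mean_mono)
    fix A
    show "1 - 4 / L\<^sup>2 * (F A - mean F)\<^sup>2 \<le> ?\<psi> A"
    proof (cases "mean F - L / 2 < F A")
      case False
      then have "(L / 2)\<^sup>2 \<le> (mean F - F A)\<^sup>2" using L by (intro power_mono) auto
      then have "L\<^sup>2 \<le> 4 * (F A - mean F)\<^sup>2"
        by (simp add: power_divide power2_commute)
      then show ?thesis using False L by (simp add: field_simps)
    qed simp
  qed
  then have "1 - 4 / L\<^sup>2 * Var \<le> mean ?\<psi>"
    unfolding Var_def by (simp only: mean_diff mean_scale mean_const)
  moreover have "\<bar>(P ^^ T) ?\<psi> {} - mean ?\<psi>\<bar> \<le> 1 / 2"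
    by (rule mixed_bound) (use mixed in auto)
  ultimately have "1 / 2 \<le> 12 / L\<^sup>2 * (2 * Var + L) + 4 / L\<^sup>2 * Var" by linarith
  also have "\<dots> = 12 / L + 28 * Var / L\<^sup>2"
    using L by (simp add: field_simps power2_eq_square)
  \<comment> \<open>The constant is \<open>28 * (4 / 3)\<close>, from the variance bound.\<close>
  also have "28 * Var / L\<^sup>2 \<le> 112 / 3 * real T / L\<^sup>2"
    using Var by (intro divide_right_mono) auto
  finally show ?thesis by simp
qed

section \<open>Asymptotics in the side length\<close>

lemma untouched_fraction_ge:
  assumes "real T \<le> 1 / 8 * real n ^ 2 * ln (real n)"
  shows "1 / sqrt (real n) \<le> (1 - 1 / m) ^ T"
proof -
  have n: "real n > 0" using n_ge by simp
  have x: "0 \<le> 1 / m" "1 / m \<le> 1 / 2"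
    using card_E_ge_2 by (auto simp: field_simps)
  \<comment> \<open>This absorbs the quadratic term of
    \<open>ln (1 - x) \<ge> - x - 2 * x ^ 2\<close> into \<open>- 2 * x\<close>, where
    \<open>x = 1 / m\<close>.\<close>
  have "(1 / m)\<^sup>2 \<le> 1 / m * (1 / 2)"
    unfolding power2_eq_square using x by (intro mult_left_mono)
  then have "- (2 * (1 / m)) \<le> ln (1 - 1 / m)"
    using ln_one_minus_pos_lower_bound[OF x] by simp
  moreover have "ln (real n) \<ge> 0" using n_ge by simp
  \<comment> \<open>The factor \<open>1 / 8\<close> is chosen so that the right side is
    \<open>ln n / 2\<close>, leaving a fraction \<open>1 / sqrt n\<close> untouched.\<close>
  then have "real T * (2 * (1 / m)) \<le> (1 / 8 * real n ^ 2 * ln (real n)) * (2 * (1 / (real n ^ 2 / 2)))"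
    using assms card_E_ge card_E_ge_2 n
    by (intro mult_mono divide_left_mono mult_pos_pos) (auto simp: zero_less_power)
  then have "real T * (2 * (1 / m)) \<le> ln (real n) / 2"
    using n by (simp add: field_simps)
  ultimately have "- (ln (real n) / 2) \<le> real T * ln (1 - 1 / m)"
    by (smt (verit) mult_left_mono mult_minus_right of_nat_0_le_iff)
  also have "\<dots> = ln ((1 - 1 / m) ^ T)"
    using card_E_ge_2 by (simp add: ln_realpow)
  finally have "ln (1 / sqrt (real n)) \<le> ln ((1 - 1 / m) ^ T)"
    using n by (simp add: ln_div ln_sqrt)
  then show ?thesis
    using n card_E_ge_2 by (subst (asm) ln_le_cancel_iff) auto
qed

text \<open>A smaller mixing time would make \<open>L\<close> at least \<open>l\<close>, of order
  \<open>n * sqrt n\<close>. The two error terms, bounded by the sum in \<open>large\<close>, could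
  then not reach \<open>1 / 2\<close>.\<close>

lemma mixing_time_lower_bound:
  assumes large: "24 / (p_low * (real n * sqrt (real n))) + 56 / 3 * ln (real n) / (p_low\<^sup>2 * real n) < 1 / 2"
  shows "1 / 8 * real n ^ 2 * ln (real n) \<le> real (mixing_time n p q \<eta>)"
proof (rule ccontr)
  assume neg: "\<not> ?thesis"
  define T where "T = mixing_time n p q \<eta>"
  define L where "L = (1 - 1 / m) ^ T * mean F"
  have n: "real n > 0" using n_ge by simp
  have T: "real T \<le> 1 / 8 * real n ^ 2 * ln (real n)"
    using neg by (simp add: T_def)
  define l where "l = p_low * (real n * sqrt (real n)) / 2"
  have "l > 0" unfolding l_def using p_low_bounds n by simp
  have "l = p_low * (real n * (real n / sqrt (real n))) / 2"
    using n by (simp add: l_def real_div_sqrt)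
  also have "\<dots> = 1 / sqrt (real n) * (p_low * (real n ^ 2 / 2))"
    by (simp add: power2_eq_square)
  also have "\<dots> \<le> (1 - 1 / m) ^ T * (p_low * m)"
    using untouched_fraction_ge[OF T] card_E_ge card_E_ge_2 p_low_bounds
    by (intro mult_mono) (auto intro!: mult_nonneg_nonneg)
  also have "\<dots> \<le> L"
    unfolding L_def using mean_F_ge card_E_ge_2 by (intro mult_left_mono) auto
  finally have lL: "l \<le> L" .
  then have "L > 0" using \<open>l > 0\<close> by simp
  then have "1 / 2 \<le> 12 / L + 112 / 3 * real T / L\<^sup>2"
    unfolding L_def by (intro mixed_imp_bound) (simp_all add: T_def mixed_mixing_time)
  also have "\<dots> \<le> 12 / l + 112 / 3 * (1 / 8 * real n ^ 2 * ln (real n)) / l\<^sup>2"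
  proof -
    have "0 \<le> 112 / 3 * (1 / 8 * real n ^ 2 * ln (real n))"
      using n_ge by simp
    moreover have "112 / 3 * real T \<le> 112 / 3 * (1 / 8 * real n ^ 2 * ln (real n))"
      using T by (rule mult_left_mono) simp
    moreover have "0 < l\<^sup>2" "l\<^sup>2 \<le> L\<^sup>2"
      using lL \<open>l > 0\<close> by (auto intro: power_mono)
    ultimately have "112 / 3 * real T / L\<^sup>2 \<le> 112 / 3 * (1 / 8 * real n ^ 2 * ln (real n)) / l\<^sup>2"
      by (rule frac_le)
    moreover have "12 / L \<le> 12 / l"
      using lL \<open>l > 0\<close> by (intro divide_left_mono mult_pos_pos) auto
    ultimately show ?thesis by (intro add_mono)
  qed
  also have "l\<^sup>2 = p_low\<^sup>2 * (real n ^ 2 * real n) / 4"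
    by (simp add: l_def power_mult_distrib power_divide)
  also have "12 / l + 112 / 3 * (1 / 8 * real n ^ 2 * ln (real n)) / (p_low\<^sup>2 * (real n ^ 2 * real n) / 4)
      = 24 / (p_low * (real n * sqrt (real n))) + 56 / 3 * ln (real n) / (p_low\<^sup>2 * real n)"
    using n p_low_bounds by (simp add: l_def field_simps)
  finally show False using large by simp
qed

end

theorem theorem6p1:
  fixes p q :: real
  assumes "q \<ge> 1" and "0 < p" and "p < sqrt q / (sqrt q + 1)"
  shows "\<exists>c > 0. \<exists>N. \<forall>n \<ge> N. \<forall>\<eta>.
           partition_on (boundary n) \<eta> \<and> side_homogeneous n \<eta> \<longrightarrow>
           c * real n ^ 2 * ln (real n) \<le> real (mixing_time n p q \<eta>)"
proof -
  have "sqrt q / (sqrt q + 1) < 1"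
    using assms(1) by (simp add: add_pos_nonneg)
  then have p: "p < 1" using assms(3) by simp
  \<comment> \<open>This is \<open>p_low\<close> as an expression in \<open>p\<close> and
    \<open>q\<close> alone, so that the threshold \<open>N\<close> is uniform in the boundary
    condition.\<close>
  define r where "r = p / (p + q * (1 - p))"
  \<comment> \<open>An arbitrary instance, used to obtain the positivity of
    \<open>r\<close>.\<close>
  interpret rc2: random_cluster 2 p q "{}"
    by unfold_locales (use assms p in auto)
  have "r > 0" using rc2.p_low_bounds(1) by (simp add: r_def rc2.p_low_def)
  then have "eventually (\<lambda>n. 24 / (r * (real n * sqrt (real n)))
      + 56 / 3 * ln (real n) / (r\<^sup>2 * real n) < 1 / 2) sequentially"
    by real_asymp
  then obtain N where N: "\<And>n. n \<ge> N \<Longrightarrow> 24 / (r * (real n * sqrt (real n)))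
      + 56 / 3 * ln (real n) / (r\<^sup>2 * real n) < 1 / 2"
    by (auto simp: eventually_sequentially)
  have "1 / 8 * real n ^ 2 * ln (real n) \<le> real (mixing_time n p q \<eta>)" if "n \<ge> max N 2" for n \<eta>
  proof -
    interpret random_cluster n p q \<eta>
      by unfold_locales (use assms p that in auto)
    show ?thesis
      by (rule mixing_time_lower_bound) (use N[of n] that in \<open>simp add: p_low_def flip: r_def\<close>)
  qed
  then show ?thesis
    by (intro exI[of _ "1 / 8"] conjI exI[of _ "max N 2"]) auto
qed

end
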